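(* Let $k\in\mathbb{R}\setminus\{0\}$, $\varrho_k(x)=\exp(-2\pi i k x)$ for $x\in[0,1]$, and $n\ge1$. Consider the space $H^1([0,1])$. For nodes $0\le x_1<\dots<x_n\le 1$ put $L_0=x_1$, $L_j=x_{j+1}-x_j$ for $j=1,\dots,n-1$, $L_n=1-x_n$, and $N(f)=(f(x_1),\dots,f(x_n))$. Then the radius of information is $$r(N)=\frac{1}{2\pi|k|}\left(L_0-\frac{\sin(2\pi kL_0)}{\pi k}+L_n-\frac{\sin(2\pi kL_n)}{\pi k}+1-\frac{1}{\pi^2k^2}\sum_{j=1}^{n-1}\frac{\sin^2(\pi kL_j)}{L_j}\right)^{1/2}.$$ Moreover, if $n-1\ge 2.7|k|$, then the nodes determined by $x_1=1-x_n=x^*$ and equidistant $$x_j=\frac{j-1}{n-1}\,(x_n-x_1)+x_1,\qquad j=2,\dots,n-1,$$ are optimal in the worst case, i.e. they minimize $r(N)$ over all choices of nodes $0\le x_1<\dots<x_n\le1$. Here $x^*=x^*(|k|,n)$ is the unique stationary point in the interval $\left(0,\min\left(\frac12,\frac{1}{6|k|}\right)\right)$ of the function $$S(x)=2x-\frac{2\sin(2\pi kx)}{\pi k}-\frac{(n-1)^2}{\pi^2k^2}\,\frac{\sin^2\left(\pi k\cdot\frac{1-2x}{n-1}\right)}{1-2x}.$$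
   Context: $H^1([0,1])$ is the space of all absolutely continuous $f:[0,1]\to\mathbb{C}$ with $f'\in L_2([0,1])$, equipped with the semi-norm $\|f\|:=\|f'\|_{L_2}$. Set $I_{\varrho_k}(f)=\int_0^1 f(x)\varrho_k(x)\,dx$. The radius of the information $N$ is $r(N)=\sup\{|I_{\varrho_k}(f)|: f\in H^1([0,1]),\ \|f\|\le1,\ N(f)=0\}$; it equals the worst case error over $\{f\in H^1([0,1]):\|f\|\le 1\}$ of an optimal algorithm using the information $N$. *)

theory Defs
  imports "HOL-Analysis.Analysis"
begin

definition absolutely_continuous_on_interval :: "real \<Rightarrow> real \<Rightarrow> (real \<Rightarrow> complex) \<Rightarrow> bool" where
  "absolutely_continuous_on_interval a b f \<longleftrightarrow>
     (\<forall>\<epsilon>>0. \<exists>\<delta>>0. \<forall>(m::nat) (u::nat \<Rightarrow> real) v.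
        (\<forall>i<m. a \<le> u i \<and> u i \<le> v i \<and> v i \<le> b) \<and>
        disjoint_family_on (\<lambda>i. {u i<..<v i}) {..<m} \<and>
        (\<Sum>i<m. v i - u i) < \<delta>
        \<longrightarrow> (\<Sum>i<m. cmod (f (v i) - f (u i))) < \<epsilon>)"

(* A function on [0,1] is represented by a total function; everything below depends only on
   its values on [0,1], whence the one-sided derivatives at the end points. At points where
   the derivative does not exist this is an unspecified value. *)
definition deriv01 :: "(real \<Rightarrow> complex) \<Rightarrow> real \<Rightarrow> complex" where
  "deriv01 f x = vector_derivative f (at x within {0..1})"

(* The almost everywhere differentiability in the definition of H1 is implied by absolute
   continuity (Lebesgue). It is stated so that "f' is in L2" visibly refers to the actual
   derivative, not to the unspecified values of deriv01. *)
definition H1 :: "(real \<Rightarrow> complex) set" where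
  "H1 = {f. absolutely_continuous_on_interval 0 1 f \<and>
            (AE x in lebesgue_on {0..1}. f differentiable (at x within {0..1})) \<and>
            deriv01 f \<in> borel_measurable (lebesgue_on {0..1}) \<and>
            integrable (lebesgue_on {0..1}) (\<lambda>x. (cmod (deriv01 f x))\<^sup>2)}"

definition H1_seminorm :: "(real \<Rightarrow> complex) \<Rightarrow> real" where
  "H1_seminorm f = sqrt (integral\<^sup>L (lebesgue_on {0..1}) (\<lambda>x. (cmod (deriv01 f x))\<^sup>2))"

definition rho :: "real \<Rightarrow> real \<Rightarrow> complex" where
  "rho k x = exp (- 2 * complex_of_real pi * \<i> * complex_of_real k * complex_of_real x)"

definition weighted_integral :: "(real \<Rightarrow> complex) \<Rightarrow> (real \<Rightarrow> complex) \<Rightarrow> complex" where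
  "weighted_integral w f = integral\<^sup>L (lebesgue_on {0..1}) (\<lambda>x. f x * w x)"

(* Nodes are indexed by 1..n; the values of the sequence at other indices are irrelevant. *)
definition admissible_nodes :: "nat \<Rightarrow> (nat \<Rightarrow> real) \<Rightarrow> bool" where
  "admissible_nodes n x \<longleftrightarrow> 0 \<le> x 1 \<and> strict_mono_on {1..n} x \<and> x n \<le> 1"

definition information :: "nat \<Rightarrow> (nat \<Rightarrow> real) \<Rightarrow> (real \<Rightarrow> complex) \<Rightarrow> complex list" where
  "information n x f = map (\<lambda>j. f (x j)) [1..<n+1]"

(* The supremum is taken in the extended reals, so that an unbounded set would give infinity. *)
definition radius :: "real \<Rightarrow> nat \<Rightarrow> (nat \<Rightarrow> real) \<Rightarrow> ereal" where
  "radius k n x =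
     (SUP f \<in> {f \<in> H1. H1_seminorm f \<le> 1 \<and> information n x f = replicate n 0}.
        ereal (cmod (weighted_integral (rho k) f)))"

definition gap :: "nat \<Rightarrow> (nat \<Rightarrow> real) \<Rightarrow> nat \<Rightarrow> real" where
  "gap n x j = (if j = 0 then x 1 else if j = n then 1 - x n else x (j + 1) - x j)"

definition optimal_nodes :: "real \<Rightarrow> nat \<Rightarrow> (nat \<Rightarrow> real) \<Rightarrow> bool" where
  "optimal_nodes k n x \<longleftrightarrow>
     admissible_nodes n x \<and> (\<forall>y. admissible_nodes n y \<longrightarrow> radius k n x \<le> radius k n y)"

definition S_fun :: "real \<Rightarrow> nat \<Rightarrow> real \<Rightarrow> real" where
  "S_fun k n x = 2 * x - 2 * sin (2 * pi * k * x) / (pi * k)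
     - (real n - 1)\<^sup>2 / (pi\<^sup>2 * k\<^sup>2)
       * ((sin (pi * k * ((1 - 2 * x) / (real n - 1))))\<^sup>2 / (1 - 2 * x))"

definition stationary_point :: "(real \<Rightarrow> real) \<Rightarrow> real \<Rightarrow> bool" where
  "stationary_point g t \<longleftrightarrow> (g has_real_derivative 0) (at t)"

end

theory Submission
  imports Defs
begin

text \<open>
  Let \<open>P\<close> be a primitive of \<open>\<varrho>\<^sub>k\<close>. For \<open>f\<close> vanishing at the nodes, integration by parts on each
  subinterval gives \<open>\<integral> f \<varrho>\<^sub>k = - \<integral> f' (P - c)\<close> for every step function \<open>c\<close> which has the value
  \<open>P 0\<close> left of the first node and \<open>P 1\<close> right of the last one. Choosing the mean of \<open>P\<close> as the
  value of \<open>c\<close> between two neighbouring nodes makes the function with derivative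
  \<open>cnj (P - c)\<close> vanish at all nodes, so the Cauchy--Schwarz bound \<open>\<parallel>P - c\<parallel>\<close> is attained and is the
  radius.

  Up to constants, the squared radius is a sum of \<open>\<theta> / 2 - sin \<theta>\<close> over the two boundary gaps minus
  a sum of \<open>sin\<^sup>2 u / u\<close> over the inner gaps. The first function lies above its tangents
  at all points of \<open>[0, \<pi>/3]\<close>, the second one below its tangents at all points of \<open>(0, \<pi>/2.7]\<close>, on the
  whole half-line although neither is globally convex or concave. Adding the tangent inequalities
  at the proposed gaps, the linear terms cancel because \<open>x\<^sup>*\<close> is stationary.
\<close>

section \<open>Absolutely continuous functions\<close>

text \<open>The definition numbers its intervals by an initial segment of the naturals. A bijection
  carries the estimate over to any finite index set, so that the tagged pieces of a division can
  serve as their own indices.\<close>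

lemma absolutely_continuous_on_intervalD:
  assumes "absolutely_continuous_on_interval a b f" "\<epsilon> > 0"
  shows "\<exists>\<delta>>0. \<forall>(I :: 'i set) u v. finite I \<and> (\<forall>i\<in>I. a \<le> u i \<and> u i \<le> v i \<and> v i \<le> b) \<and>
       disjoint_family_on (\<lambda>i. {u i<..<v i}) I \<and> (\<Sum>i\<in>I. v i - u i) < \<delta> \<longrightarrow>
       (\<Sum>i\<in>I. cmod (f (v i) - f (u i))) < \<epsilon>"
proof -
  obtain \<delta> where "\<delta> > 0" and \<delta>: "\<forall>(m::nat) (u::nat \<Rightarrow> real) v.
        (\<forall>i<m. a \<le> u i \<and> u i \<le> v i \<and> v i \<le> b) \<and>
        disjoint_family_on (\<lambda>i. {u i<..<v i}) {..<m} \<and>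
        (\<Sum>i<m. v i - u i) < \<delta>
        \<longrightarrow> (\<Sum>i<m. cmod (f (v i) - f (u i))) < \<epsilon>"
    using assms(1)[unfolded absolutely_continuous_on_interval_def, THEN spec, THEN mp, OF assms(2)]
    by (elim exE conjE) (rule that)
  show ?thesis
  proof (intro exI[of _ \<delta>] conjI allI impI \<open>\<delta> > 0\<close>)
    fix I :: "'i set" and u v :: "'i \<Rightarrow> real"
    assume *: "finite I \<and> (\<forall>i\<in>I. a \<le> u i \<and> u i \<le> v i \<and> v i \<le> b) \<and>
      disjoint_family_on (\<lambda>i. {u i<..<v i}) I \<and> (\<Sum>i\<in>I. v i - u i) < \<delta>"
    then have fin: "finite I" and uv: "\<And>i. i \<in> I \<Longrightarrow> a \<le> u i \<and> u i \<le> v i \<and> v i \<le> b"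
      and disj: "disjoint_family_on (\<lambda>i. {u i<..<v i}) I" and less: "(\<Sum>i\<in>I. v i - u i) < \<delta>"
      by auto
    obtain h where h: "bij_betw h {..<card I} I"
      using ex_bij_betw_nat_finite[OF fin] by (auto simp: lessThan_atLeast0)
    have hI: "h i \<in> I" if "i < card I" for i
      using h that by (auto simp: bij_betw_def)
    have "disjoint_family_on (\<lambda>i. {u (h i)<..<v (h i)}) {..<card I}"
      unfolding disjoint_family_on_def
    proof (intro ballI impI)
      fix i j assume ij: "i \<in> {..<card I}" "j \<in> {..<card I}" "i \<noteq> j"
      then have "h i \<noteq> h j"
        using h by (auto simp: bij_betw_def dest: inj_onD)
      then show "{u (h i)<..<v (h i)} \<inter> {u (h j)<..<v (h j)} = {}"
        using disjoint_family_onD[OF disj, of "h i" "h j"] hI ij by auto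
    qed
    moreover have "(\<Sum>i<card I. v (h i) - u (h i)) < \<delta>"
      using less sum.reindex_bij_betw[OF h, of "\<lambda>i. v i - u i"] by simp
    ultimately have "(\<Sum>i<card I. cmod (f (v (h i)) - f (u (h i)))) < \<epsilon>"
      using \<delta>[THEN spec[of _ "card I"], THEN spec[of _ "\<lambda>i. u (h i)"], THEN spec[of _ "\<lambda>i. v (h i)"]] uv hI by auto
    then show "(\<Sum>i\<in>I. cmod (f (v i) - f (u i))) < \<epsilon>"
      using sum.reindex_bij_betw[OF h, of "\<lambda>i. cmod (f (v i) - f (u i))"] by simp
  qed
qed

lemma absolutely_continuous_on_interval_subset:
  assumes "absolutely_continuous_on_interval a b f" "a \<le> c" "d \<le> b"
  shows "absolutely_continuous_on_interval c d f"
  unfolding absolutely_continuous_on_interval_def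
proof (intro allI impI)
  fix \<epsilon> :: real assume e: "\<epsilon> > 0"
  obtain \<delta> where "\<delta> > 0" and \<delta>: "\<forall>(m::nat) (u::nat \<Rightarrow> real) v.
      (\<forall>i<m. a \<le> u i \<and> u i \<le> v i \<and> v i \<le> b) \<and>
      disjoint_family_on (\<lambda>i. {u i<..<v i}) {..<m} \<and> (\<Sum>i<m. v i - u i) < \<delta> \<longrightarrow>
      (\<Sum>i<m. cmod (f (v i) - f (u i))) < \<epsilon>"
    using assms(1)[unfolded absolutely_continuous_on_interval_def, THEN spec, THEN mp, OF e]
    by (elim exE conjE) (rule that)
  show "\<exists>\<delta>>0. \<forall>(m::nat) (u::nat \<Rightarrow> real) v. (\<forall>i<m. c \<le> u i \<and> u i \<le> v i \<and> v i \<le> d) \<and>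
           disjoint_family_on (\<lambda>i. {u i<..<v i}) {..<m} \<and> (\<Sum>i<m. v i - u i) < \<delta> \<longrightarrow>
           (\<Sum>i<m. cmod (f (v i) - f (u i))) < \<epsilon>"
  proof (intro exI[of _ \<delta>] conjI allI impI \<open>\<delta> > 0\<close>)
    fix m :: nat and u v :: "nat \<Rightarrow> real"
    assume *: "(\<forall>i<m. c \<le> u i \<and> u i \<le> v i \<and> v i \<le> d) \<and>
      disjoint_family_on (\<lambda>i. {u i<..<v i}) {..<m} \<and> (\<Sum>i<m. v i - u i) < \<delta>"
    then have "\<forall>i<m. a \<le> u i \<and> u i \<le> v i \<and> v i \<le> b"
      using assms(2,3) by force
    then show "(\<Sum>i<m. cmod (f (v i) - f (u i))) < \<epsilon>"
      using \<delta> * by blast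
  qed
qed

lemma absolutely_continuous_on_interval_imp_continuous_on:
  assumes "absolutely_continuous_on_interval a b f"
  shows "continuous_on {a..b} f"
proof (rule continuous_onI)
  fix x and e :: real assume x: "x \<in> {a..b}" and e: "e > 0"
  \<comment> \<open>Continuity needs only one interval, hence the index type \<open>unit\<close>;
    \<open>min\<close> and \<open>max\<close> below put its end points in order.\<close>
  obtain \<delta> where "\<delta> > 0" and \<delta>: "\<forall>(I :: unit set) u v.
       finite I \<and> (\<forall>i\<in>I. a \<le> u i \<and> u i \<le> v i \<and> v i \<le> b) \<and>
       disjoint_family_on (\<lambda>i. {u i<..<v i}) I \<and> (\<Sum>i\<in>I. v i - u i) < \<delta> \<longrightarrow>
       (\<Sum>i\<in>I. cmod (f (v i) - f (u i))) < e"
      using absolutely_continuous_on_intervalD[OF assms e, where 'i=unit]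
      by (elim exE conjE) (rule that)
  have "dist (f y) (f x) < e" if "y \<in> {a..b}" "dist y x < \<delta>" for y
    using \<delta>[THEN spec[of _ "{()}"], THEN spec[of _ "\<lambda>_. min x y"], THEN spec[of _ "\<lambda>_. max x y"]] that x
    by (auto simp: disjoint_family_on_def dist_norm min_def max_def norm_minus_commute split: if_splits)
  then show "\<exists>d>0. \<forall>x'\<in>{a..b}. dist x' x < d \<longrightarrow> dist (f x') (f x) \<le> e"
    using \<open>\<delta> > 0\<close> by (meson less_imp_le)
qed

text \<open>The gauge treats two kinds of tags. Off \<open>N\<close> it comes from
  differentiability, as in the classical theorem. On \<open>N\<close> it is an open superset of
  small measure, and absolute continuity bounds the total increment of \<open>f\<close> over the
  pieces tagged there.\<close>

lemma fundamental_theorem_of_calculus_absolutely_continuous: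
  assumes ac: "absolutely_continuous_on_interval a b f" and "a \<le> b" and N: "negligible N"
    and der: "\<And>x. x \<in> {a..b} - N \<Longrightarrow> (f has_vector_derivative f' x) (at x within {a..b})"
  shows "(f' has_integral (f b - f a)) {a..b}"
proof (cases "a = b")
  case True
  then show ?thesis by auto
next
  case False
  with \<open>a \<le> b\<close> have ab: "a < b" by simp
  \<comment> \<open>\<open>f'\<close> is arbitrary on \<open>N\<close>. With the value 0 there, a
    piece tagged in \<open>N\<close> contributes only the increment of \<open>f\<close>; the spike
    at the end restores \<open>f'\<close>.\<close>
  define g where "g x = (if x \<in> N then 0 else f' x)" for x
  have "(g has_integral (f b - f a)) {a..b}"
    unfolding has_integral_factor_content_real
  proof (intro allI impI)
    fix e :: real assume e: "e > 0"
    have "\<exists>d>0. x \<in> {a..b} - N \<longrightarrow>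
         (\<forall>y\<in>{a..b}. norm (y-x) < d \<longrightarrow> norm (f y - f x - (y-x) *\<^sub>R f' x) \<le> (e/2) * norm (y-x))" for x
    proof (cases "x \<in> {a..b} - N")
      case True
      then show ?thesis
        using der[OF True, unfolded has_vector_derivative_def has_derivative_within_alt] half_gt_zero[OF e]
        by blast
    qed (auto intro: exI[of _ 1])
    then obtain d where d0: "\<And>x. 0 < d x"
      and d': "\<And>x. x \<in> {a..b} - N \<longrightarrow> (\<forall>y\<in>{a..b}. norm (y-x) < d x \<longrightarrow>
             norm (f y - f x - (y-x) *\<^sub>R f' x) \<le> (e/2) * norm (y-x))"
      by metis
    have d: "\<And>x y. \<lbrakk>x \<in> {a..b} - N; y \<in> {a..b}; norm (y-x) < d x\<rbrakk>
             \<Longrightarrow> norm (f y - f x - (y-x) *\<^sub>R f' x) \<le> (e/2) * norm (y-x)"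
      using d' by blast
    have pos: "e/2 * (b - a) > 0" using e ab by simp
    obtain \<delta> where "\<delta> > 0" and \<delta>: "\<forall>(I :: (real \<times> real set) set) u v.
       finite I \<and> (\<forall>i\<in>I. a \<le> u i \<and> u i \<le> v i \<and> v i \<le> b) \<and>
       disjoint_family_on (\<lambda>i. {u i<..<v i}) I \<and> (\<Sum>i\<in>I. v i - u i) < \<delta> \<longrightarrow>
       (\<Sum>i\<in>I. cmod (f (v i) - f (u i))) < e/2 * (b - a)"
      using absolutely_continuous_on_intervalD[OF ac pos, where 'i="real \<times> real set"]
      by (elim exE conjE) (rule that)
    obtain U where U: "open U" "N \<subseteq> U" "U \<in> lmeasurable" "measure lebesgue U < \<delta>"
    proof -
      have "N \<in> sets lebesgue"
        using N by (auto simp: negligible_iff_null_sets)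
      then obtain U where U: "open U" "N \<subseteq> U" "(U - N) \<in> lmeasurable" "emeasure lebesgue (U - N) < ennreal \<delta>"
        using sets_lebesgue_outer_open[OF _ \<open>\<delta> > 0\<close>, of N] by blast
      have "N \<in> lmeasurable" "measure lebesgue N = 0"
        using N by (auto simp: negligible_imp_measurable negligible_imp_measure0)
      have eq: "U = (U - N) \<union> N" using U by auto
      have "U \<in> lmeasurable" using U(3) \<open>N \<in> lmeasurable\<close> eq fmeasurable.Un by metis
      moreover have "measure lebesgue (U - N) < \<delta>"
        using U(3,4) by (simp add: emeasure_eq_measure2 ennreal_less_iff)
      moreover have "measure lebesgue U \<le> measure lebesgue (U - N) + measure lebesgue N"
        using eq measure_Un_le[of "U - N" lebesgue N] U(3) \<open>N \<in> lmeasurable\<close> by auto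
      ultimately show ?thesis using that U \<open>measure lebesgue N = 0\<close> by auto
    qed
    define \<gamma> where "\<gamma> x = (if x \<in> N then U else ball x (d x))" for x
    show "\<exists>d. gauge d \<and> (\<forall>p. p tagged_division_of {a..b} \<and> d fine p \<longrightarrow>
        norm ((\<Sum>(x, k)\<in>p. measure lborel k *\<^sub>R g x) - (f b - f a)) \<le> e * measure lborel {a..b})"
    proof (intro exI conjI allI impI)
      show "gauge \<gamma>" using U d0 by (auto simp: gauge_def \<gamma>_def)
      fix p assume "p tagged_division_of {a..b} \<and> \<gamma> fine p"
      then have p: "p tagged_division_of {a..b}" and fine: "\<gamma> fine p" by auto
      note pD = tagged_division_ofD[OF p]
      have Kp: "Inf K \<in> K \<and> Sup K \<in> K \<and> (\<forall>y\<in>K. Inf K \<le> y \<and> y \<le> Sup K) \<and> Inf K \<le> Sup K \<and> a \<le> Inf K \<and> Sup K \<le> b \<and> measure lborel K = Sup K - Inf K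
           \<and> x \<in> K \<and> interior K = {Inf K<..<Sup K} \<and> K \<subseteq> \<gamma> x" if xK: "(x,K) \<in> p" for x K
      proof -
        obtain u v where K: "K = {u..v}" using pD(4)[OF xK] by (metis box_real(2))
        have x: "x \<in> K" "K \<subseteq> {a..b}" using pD(2,3)[OF xK] by auto
        have "K \<subseteq> \<gamma> x" using fine xK by blast
        moreover have "u \<le> v" using x K by auto
        ultimately show ?thesis using x unfolding K by (auto simp: interior_atLeastAtMost_real)
      qed
      let ?N = "{(x,K)\<in>p. x \<in> N}" and ?R = "{(x,K)\<in>p. x \<notin> N}"
      have fin: "finite ?N" "finite ?R" and pU: "p = ?N \<union> ?R" "?N \<inter> ?R = {}"
        using pD(1) by (auto intro: rev_finite_subset)
      let ?D = "\<lambda>(x,K). measure lborel K *\<^sub>R g x - (f (Sup K) - f (Inf K))"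
      have ba: "b - a = (\<Sum>(x,K)\<in>p. Sup K - Inf K)" "f b - f a = (\<Sum>(x,K)\<in>p. f (Sup K) - f (Inf K))"
        using additive_tagged_division_1[where f= "\<lambda>x. x"] additive_tagged_division_1[where f= f]
          \<open>a \<le> b\<close> p by auto
      have "norm (sum ?D ?R) \<le> (\<Sum>(x,K)\<in>?R. (e/2) * (Sup K - Inf K))"
      proof (rule sum_norm_le, clarify)
        fix x K assume xK: "(x, K) \<in> p" and "x \<notin> N"
        note K = Kp[OF xK]
        define u v where "u = Inf K" and "v = Sup K"
        have K': "u \<in> K" "v \<in> K" "u \<le> x" "x \<le> v" "a \<le> u" "v \<le> b"
          using K unfolding u_def v_def by auto
        have "K \<subseteq> ball x (d x)" using K \<open>x \<notin> N\<close> by (simp add: \<gamma>_def)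
        then have b: "norm (u - x) < d x" "norm (v - x) < d x"
          using K' by (auto simp: dist_real_def)
        \<comment> \<open>The tag lies between the end points of its piece, so the linear
          approximation errors at \<open>u\<close> and at \<open>v\<close> add up to a multiple of
          the length \<open>v - u\<close>.\<close>
        have "norm ((v - u) *\<^sub>R f' x - (f v - f u)) = norm (f u - f x - (u - x) *\<^sub>R f' x - (f v - f x - (v - x) *\<^sub>R f' x))"
          by (auto simp: algebra_simps)
        also have "\<dots> \<le> norm (f u - f x - (u - x) *\<^sub>R f' x) + norm (f v - f x - (v - x) *\<^sub>R f' x)"
          by (rule norm_triangle_ineq4)
        also have "\<dots> \<le> e/2 * norm (u - x) + e/2 * norm (v - x)"
          using K' b \<open>x \<notin> N\<close> by (intro add_mono d) auto
        also have "\<dots> = e/2 * (v - u)"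
          using K' by (auto simp: field_simps)
        finally show "norm (measure lborel K *\<^sub>R g x - (f (Sup K) - f (Inf K))) \<le> e/2 * (Sup K - Inf K)"
          using K \<open>x \<notin> N\<close> by (simp add: g_def u_def v_def)
      qed
      also have "\<dots> \<le> (\<Sum>(x,K)\<in>p. (e/2) * (Sup K - Inf K))"
        using pD(1) e Kp by (intro sum_mono2) (auto simp: less_imp_le)
      also have "\<dots> = e/2 * (b - a)"
        unfolding ba(1) by (simp add: sum_distrib_left split_def)
      finally have R: "norm (sum ?D ?R) \<le> e/2 * (b - a)" .
      have "norm (sum ?D ?N) \<le> (\<Sum>i\<in>?N. cmod (f (Sup (snd i)) - f (Inf (snd i))))"
        by (rule sum_norm_le) (auto simp: g_def norm_minus_commute)
      also have "\<dots> < e/2 * (b - a)"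
      proof -
        have bds: "a \<le> Inf (snd i) \<and> Inf (snd i) \<le> Sup (snd i) \<and> Sup (snd i) \<le> b" if "i \<in> ?N" for i
          using that Kp[of "fst i" "snd i"] by (simp add: case_prod_beta)
        have int: "interior (snd i) = {Inf (snd i)<..<Sup (snd i)}" if "i \<in> ?N" for i
          using that Kp[of "fst i" "snd i"] by (simp add: case_prod_beta)
        have "{Inf (snd i)<..<Sup (snd i)} \<inter> {Inf (snd j)<..<Sup (snd j)} = {}" if "i \<in> ?N" "j \<in> ?N" "i \<noteq> j" for i j
          using pD(5)[of "fst i" "snd i" "fst j" "snd j"] that int[OF that(1)] int[OF that(2)]
          by (simp add: case_prod_beta prod_eq_iff)
        then have disj: "disjoint_family_on (\<lambda>i. {Inf (snd i)<..<Sup (snd i)}) ?N"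
          unfolding disjoint_family_on_def by (intro ballI impI)
        \<comment> \<open>The pieces tagged in \<open>N\<close> have disjoint interiors inside
          \<open>U\<close>, so their total length is at most the measure of
          \<open>U\<close>.\<close>
        have "(\<Sum>i\<in>?N. Sup (snd i) - Inf (snd i)) = (\<Sum>i\<in>?N. measure lebesgue {Inf (snd i)<..<Sup (snd i)})"
          using bds by (intro sum.cong refl) simp
        also have "\<dots> = measure lebesgue (\<Union>i\<in>?N. {Inf (snd i)<..<Sup (snd i)})"
        proof (rule measure_finite_Union[symmetric])
          show "(\<lambda>i. {Inf (snd i)<..<Sup (snd i)}) ` ?N \<subseteq> sets lebesgue"
            by (rule image_subsetI) simp
          show "emeasure lebesgue {Inf (snd i)<..<Sup (snd i)} \<noteq> \<infinity>" if "i \<in> ?N" for i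
            using bds[OF that] by simp
        qed (rule fin(1), rule disj)
        also have "\<dots> \<le> measure lebesgue U"
        proof (rule measure_mono_fmeasurable)
          show "(\<Union>i\<in>?N. {Inf (snd i)<..<Sup (snd i)}) \<subseteq> U"
          proof (rule UN_least)
            fix i assume "i \<in> ?N"
            then have "interior (snd i) \<subseteq> \<gamma> (fst i)" "fst i \<in> N"
              using Kp[of "fst i" "snd i"] interior_subset[of "snd i"] by auto
            then show "{Inf (snd i)<..<Sup (snd i)} \<subseteq> U"
              using int[OF \<open>i \<in> ?N\<close>] by (simp add: \<gamma>_def)
          qed
        qed (use U fin in auto)
        also have "\<dots> < \<delta>" by fact
        finally have "(\<Sum>i\<in>?N. Sup (snd i) - Inf (snd i)) < \<delta>" .
        then show ?thesis
          by (intro \<delta>[THEN spec[of _ ?N], THEN spec[of _ "\<lambda>i. Inf (snd i)"],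
              THEN spec[of _ "\<lambda>i. Sup (snd i)"], THEN mp] conjI fin(1) disj ballI bds)
      qed
      finally have N: "norm (sum ?D ?N) \<le> e/2 * (b - a)" by simp
      have "(\<Sum>(x, k)\<in>p. measure lborel k *\<^sub>R g x) - (f b - f a) = sum ?D p"
        unfolding ba(2) by (simp add: split_def sum_subtractf)
      also have "\<dots> = sum ?D ?N + sum ?D ?R"
        by (subst pU(1), rule sum.union_disjoint) (use fin pU in auto)
      also have "norm \<dots> \<le> e * (b - a)"
        using N R norm_triangle_ineq[of "sum ?D ?N" "sum ?D ?R"] by (simp add: field_simps)
      finally show "norm ((\<Sum>(x, k)\<in>p. measure lborel k *\<^sub>R g x) - (f b - f a)) \<le> e * measure lborel {a..b}"
        using ab by simp
    qed
  qed
  then show ?thesis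
    by (rule has_integral_spike[OF N, rotated]) (auto simp: g_def)
qed

lemma lipschitz_on_imp_absolutely_continuous_on_interval:
  assumes L: "\<And>x y. a \<le> x \<Longrightarrow> x \<le> y \<Longrightarrow> y \<le> b \<Longrightarrow> cmod (h y - h x) \<le> L * (y - x)"
  shows "absolutely_continuous_on_interval a b h"
  unfolding absolutely_continuous_on_interval_def
proof (intro allI impI)
  fix \<epsilon> :: real assume "\<epsilon> > 0"
  \<comment> \<open>\<open>L\<close> may be zero or negative, whereas \<open>M\<close> is a positive
    Lipschitz constant by which the tolerance can be divided.\<close>
  define M where "M = \<bar>L\<bar> + 1"
  have "M > 0" by (simp add: M_def)
  show "\<exists>\<delta>>0. \<forall>(m::nat) (u::nat \<Rightarrow> real) v. (\<forall>i<m. a \<le> u i \<and> u i \<le> v i \<and> v i \<le> b) \<and>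
           disjoint_family_on (\<lambda>i. {u i<..<v i}) {..<m} \<and> (\<Sum>i<m. v i - u i) < \<delta> \<longrightarrow>
           (\<Sum>i<m. cmod (h (v i) - h (u i))) < \<epsilon>"
  proof (intro exI[of _ "\<epsilon> / M"] conjI allI impI)
    fix m :: nat and u v :: "nat \<Rightarrow> real"
    assume *: "(\<forall>i<m. a \<le> u i \<and> u i \<le> v i \<and> v i \<le> b) \<and>
           disjoint_family_on (\<lambda>i. {u i<..<v i}) {..<m} \<and> (\<Sum>i<m. v i - u i) < \<epsilon> / M"
    have "cmod (h (v i) - h (u i)) \<le> M * (v i - u i)" if "i < m" for i
    proof -
      have "cmod (h (v i) - h (u i)) \<le> L * (v i - u i)" using L * that by auto
      also have "\<dots> \<le> M * (v i - u i)" using * that by (intro mult_right_mono) (auto simp: M_def)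
      finally show ?thesis .
    qed
    then have "(\<Sum>i<m. cmod (h (v i) - h (u i))) \<le> (\<Sum>i<m. M * (v i - u i))"
      by (intro sum_mono) auto
    also have "\<dots> = M * (\<Sum>i<m. v i - u i)" by (simp add: sum_distrib_left)
    also have "\<dots> < \<epsilon>" using * \<open>M > 0\<close> by (simp add: field_simps)
    finally show "(\<Sum>i<m. cmod (h (v i) - h (u i))) < \<epsilon>" .
  qed (use \<open>\<epsilon> > 0\<close> \<open>M > 0\<close> in auto)
qed

text \<open>Each factor is continuous on a compact interval, hence bounded. An increment of the
  product splits as in the product rule, and the bounds \<open>B\<close> and \<open>C\<close> fix
  the tolerances granted to the two factors.\<close>

lemma absolutely_continuous_on_interval_mult:
  assumes f: "absolutely_continuous_on_interval a b f" and h: "absolutely_continuous_on_interval a b h"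
  shows "absolutely_continuous_on_interval a b (\<lambda>x. f x * h x)"
proof -
  have "bounded (f ` {a..b})" "bounded (h ` {a..b})"
    by (intro compact_imp_bounded compact_continuous_image absolutely_continuous_on_interval_imp_continuous_on f h; simp)+
  then obtain B C where "B > 0" "C > 0" and BC: "\<forall>y\<in>f ` {a..b}. cmod y \<le> B" "\<forall>y\<in>h ` {a..b}. cmod y \<le> C"
    unfolding bounded_pos by (elim exE conjE) (rule that)
  then have B: "\<And>x. x \<in> {a..b} \<Longrightarrow> cmod (f x) \<le> B" and C: "\<And>x. x \<in> {a..b} \<Longrightarrow> cmod (h x) \<le> C"
    by auto
  show ?thesis
    unfolding absolutely_continuous_on_interval_def
  proof (intro allI impI)
    fix \<epsilon> :: real assume "\<epsilon> > 0"
    then have pos: "\<epsilon> / (2 * C) > 0" "\<epsilon> / (2 * B) > 0" using \<open>B > 0\<close> \<open>C > 0\<close> by auto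
    obtain d1 where "d1 > 0" and d1: "(\<forall>(m::nat) (u::nat \<Rightarrow> real) v. (\<forall>i<m. a \<le> u i \<and> u i \<le> v i \<and> v i \<le> b) \<and>
           disjoint_family_on (\<lambda>i. {u i<..<v i}) {..<m} \<and> (\<Sum>i<m. v i - u i) < d1 \<longrightarrow>
           (\<Sum>i<m. cmod (f (v i) - f (u i))) < \<epsilon> / (2 * C))"
      using f[unfolded absolutely_continuous_on_interval_def, THEN spec, THEN mp, OF pos(1)]
      by (elim exE conjE) (rule that)
    obtain d2 where "d2 > 0" and d2: "(\<forall>(m::nat) (u::nat \<Rightarrow> real) v. (\<forall>i<m. a \<le> u i \<and> u i \<le> v i \<and> v i \<le> b) \<and>
           disjoint_family_on (\<lambda>i. {u i<..<v i}) {..<m} \<and> (\<Sum>i<m. v i - u i) < d2 \<longrightarrow>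
           (\<Sum>i<m. cmod (h (v i) - h (u i))) < \<epsilon> / (2 * B))"
      using h[unfolded absolutely_continuous_on_interval_def, THEN spec, THEN mp, OF pos(2)]
      by (elim exE conjE) (rule that)
    show "\<exists>\<delta>>0. \<forall>(m::nat) (u::nat \<Rightarrow> real) v. (\<forall>i<m. a \<le> u i \<and> u i \<le> v i \<and> v i \<le> b) \<and>
           disjoint_family_on (\<lambda>i. {u i<..<v i}) {..<m} \<and> (\<Sum>i<m. v i - u i) < \<delta> \<longrightarrow>
           (\<Sum>i<m. cmod (f (v i) * h (v i) - f (u i) * h (u i))) < \<epsilon>"
    proof (intro exI[of _ "min d1 d2"] conjI allI impI)
      fix m :: nat and u v :: "nat \<Rightarrow> real"
      assume *: "(\<forall>i<m. a \<le> u i \<and> u i \<le> v i \<and> v i \<le> b) \<and>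
           disjoint_family_on (\<lambda>i. {u i<..<v i}) {..<m} \<and> (\<Sum>i<m. v i - u i) < min d1 d2"
      have "cmod (f (v i) * h (v i) - f (u i) * h (u i)) \<le> C * cmod (f (v i) - f (u i)) + B * cmod (h (v i) - h (u i))"
        if "i < m" for i
      proof -
        have uv: "v i \<in> {a..b}" "u i \<in> {a..b}" using * that by auto
        have "f (v i) * h (v i) - f (u i) * h (u i) = h (v i) * (f (v i) - f (u i)) + f (u i) * (h (v i) - h (u i))"
          by (simp add: algebra_simps)
        also have "cmod \<dots> \<le> cmod (h (v i)) * cmod (f (v i) - f (u i)) + cmod (f (u i)) * cmod (h (v i) - h (u i))"
          by (metis norm_mult norm_triangle_ineq)
        also have "\<dots> \<le> C * cmod (f (v i) - f (u i)) + B * cmod (h (v i) - h (u i))"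
          by (intro add_mono mult_right_mono B C uv) auto
        finally show ?thesis .
      qed
      then have "(\<Sum>i<m. cmod (f (v i) * h (v i) - f (u i) * h (u i)))
          \<le> (\<Sum>i<m. C * cmod (f (v i) - f (u i)) + B * cmod (h (v i) - h (u i)))"
        by (intro sum_mono) auto
      also have "\<dots> = C * (\<Sum>i<m. cmod (f (v i) - f (u i))) + B * (\<Sum>i<m. cmod (h (v i) - h (u i)))"
        by (simp add: sum.distrib sum_distrib_left)
      also have "\<dots> < C * (\<epsilon> / (2 * C)) + B * (\<epsilon> / (2 * B))"
        using d1[THEN spec[of _ m], THEN spec[of _ u], THEN spec[of _ v]]
          d2[THEN spec[of _ m], THEN spec[of _ u], THEN spec[of _ v]] * \<open>B > 0\<close> \<open>C > 0\<close>
        by (intro add_strict_mono mult_strict_left_mono) simp_all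
      also have "\<dots> = \<epsilon>" using \<open>B > 0\<close> \<open>C > 0\<close> by (simp add: field_simps)
      finally show "(\<Sum>i<m. cmod (f (v i) * h (v i) - f (u i) * h (u i))) < \<epsilon>" .
    qed (use \<open>d1 > 0\<close> \<open>d2 > 0\<close> in auto)
  qed
qed

section \<open>Tangent inequalities\<close>

text \<open>The constant 2.7 comes from here: the maximum of \<open>sin\<^sup>2 u / u\<close> is attained where \<open>sin u = 2 u cos u\<close>,
  at \<open>u = 1.1655\<dots>\<close>, just above \<open>\<pi> / 2.7 = 1.1635\<dots>\<close>.\<close>

lemma sin_less_2u_cos:
  fixes u :: real
  assumes "0 < u" "u \<le> pi / 2.7"
  shows "sin u < 2 * u * cos u"
proof -
  \<comment> \<open>A rational point between pi / 2.7 = 1.16355... and the zero 1.1655... of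
    \<open>F\<close>, so that one numerical check at \<open>c\<close> is enough.\<close>
  define c :: real where "c = 1.1636"
  define F where "F u = 2 * u * cos u - sin u" for u :: real
  have cpi: "pi / 2.7 \<le> c" "c \<le> pi / 2" using pi_approx by (auto simp: c_def)
  have "(\<Sum>m<9. sin_coeff m * c ^ m) = c - c ^ 3 / 6 + c ^ 5 / 120 - c ^ 7 / 5040"
    by (simp add: sin_coeff_def lessThan_nat_numeral pred_numeral_simps lessThan_Suc fact_numeral)
  then have "sin c \<le> c - c ^ 3 / 6 + c ^ 5 / 120 - c ^ 7 / 5040 + c ^ 9 / 362880"
    using Maclaurin_sin_bound[of c 9] unfolding abs_le_iff by (simp add: c_def abs_le_iff fact_numeral field_simps)
  also have "\<dots> < 0.9184"
    by (simp add: c_def power_divide)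
  finally have sin_c: "sin c < 0.9184" .
  obtain t where t: "cos c = (\<Sum>m<8. cos_coeff m * c ^ m) + cos (t + 1/2 * real 8 * pi) / fact 8 * c ^ 8"
    using Maclaurin_cos_expansion[of c 8] by blast
  \<comment> \<open>The remainder of the cosine expansion is bounded below by replacing its cosine
    factor by -1. Together with the bound on \<open>sin c\<close> this suffices: 2 * 1.1636 * 0.3958
    exceeds 0.921.\<close>
  have "0.3958 < 1 - c ^ 2 / 2 + c ^ 4 / 24 - c ^ 6 / 720 + (-1) / fact 8 * c ^ 8"
    by (simp add: c_def power_divide fact_numeral)
  also have "\<dots> \<le> 1 - c ^ 2 / 2 + c ^ 4 / 24 - c ^ 6 / 720 + cos (t + 1/2 * real 8 * pi) / fact 8 * c ^ 8"
    by (intro add_left_mono mult_right_mono divide_right_mono cos_ge_minus_one) (auto simp: c_def)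
  also have "1 - c ^ 2 / 2 + c ^ 4 / 24 - c ^ 6 / 720 = (\<Sum>m<8. cos_coeff m * c ^ m)"
    by (simp add: cos_coeff_def lessThan_nat_numeral pred_numeral_simps lessThan_Suc fact_numeral)
  finally have "0.3958 < cos c" using t by simp
  then have Fc: "F c > 0" using sin_c by (simp add: F_def c_def)
  \<comment> \<open>A concave function lies above its chords; as \<open>F 0 = 0\<close> and
    \<open>F c > 0\<close>, it is positive on all of (0, c].\<close>
  have "concave_on {0..c} F"
  proof (rule f''_le0_imp_concave)
    fix x assume "x \<in> {0..c}"
    then have x: "0 \<le> x" "x \<le> pi / 2" using cpi by auto
    show "(F has_real_derivative (cos x - 2 * x * sin x)) (at x)"
      unfolding F_def by (auto intro!: derivative_eq_intros simp: algebra_simps)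
    show "((\<lambda>x. cos x - 2 * x * sin x) has_real_derivative (- 3 * sin x - 2 * x * cos x)) (at x)"
      by (auto intro!: derivative_eq_intros simp: algebra_simps)
    show "- 3 * sin x - 2 * x * cos x \<le> 0"
    proof -
      have "sin x \<ge> 0" using x by (intro sin_ge_zero) auto
      moreover have "2 * x * cos x \<ge> 0" using x by (intro mult_nonneg_nonneg cos_ge_zero) auto
      ultimately show ?thesis by linarith
    qed
  qed auto
  then have "F ((1 - u/c) *\<^sub>R 0 + (u/c) *\<^sub>R c) \<ge> (1 - u/c) * F 0 + (u/c) * F c"
    using assms cpi by (intro concave_onD) (auto simp: c_def)
  then have "F u \<ge> (u / c) * F c"
    by (simp add: F_def c_def)
  moreover have "(u / c) * F c > 0" using assms Fc by (simp add: c_def)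
  ultimately show ?thesis by (simp add: F_def)
qed

definition sinsq_over :: "real \<Rightarrow> real" where
  "sinsq_over u = (sin u)\<^sup>2 / u"

text \<open>The derivative of \<open>sinsq_over\<close>, written through sin u / u: its limit at 0
  can be read off, and sin u / u factors out, which settles the sign.\<close>

definition sinsq_over' :: "real \<Rightarrow> real" where
  "sinsq_over' u = 2 * cos u * (sin u / u) - (sin u / u)\<^sup>2"

lemma DERIV_sinsq_over:
  "u \<noteq> 0 \<Longrightarrow> (sinsq_over has_real_derivative sinsq_over' u) (at u)"
  unfolding sinsq_over_def[abs_def] sinsq_over'_def
  by (auto intro!: derivative_eq_intros simp: field_simps power2_eq_square)

lemma DERIV_sinsq_over':
  assumes "u \<noteq> 0"
  shows "(sinsq_over' has_real_derivative
    2 * (u\<^sup>2 * cos (2 * u) - u * sin (2 * u) + (sin u)\<^sup>2) / u ^ 3) (at u)"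
  unfolding sinsq_over'_def[abs_def] cos_double sin_double
  using assms by (auto intro!: derivative_eq_intros simp: field_simps power2_eq_square power3_eq_cube)

text \<open>The numerator without its factor 2 vanishes at 0 and has derivative -2 u^2 sin (2 u),
  which is nonpositive on [0, pi/2].\<close>

lemma sinsq_over''_nonpos:
  assumes "0 < u" "u \<le> pi / 2"
  shows "2 * (u\<^sup>2 * cos (2 * u) - u * sin (2 * u) + (sin u)\<^sup>2) / u ^ 3 \<le> 0"
proof -
  define q where "q u = u\<^sup>2 * cos (2 * u) - u * sin (2 * u) + (sin u)\<^sup>2" for u :: real
  have "q u \<le> q 0"
  proof (rule DERIV_nonpos_imp_nonincreasing[of 0 u q])
    fix x assume x: "0 \<le> x" "x \<le> u"
    have "(q has_real_derivative - (2 * x\<^sup>2 * sin (2 * x))) (at x)"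
      unfolding q_def sin_double cos_double
      by (auto intro!: derivative_eq_intros simp: algebra_simps power2_eq_square)
    moreover have "sin (2 * x) \<ge> 0" using x assms by (intro sin_ge_zero) auto
    ultimately show "\<exists>y. (q has_real_derivative y) (at x) \<and> y \<le> 0"
      by (intro exI conjI) auto
  qed (use assms in auto)
  then have "u\<^sup>2 * cos (2 * u) - u * sin (2 * u) + (sin u)\<^sup>2 \<le> 0"
    by (simp add: q_def)
  then show ?thesis using assms by (simp add: divide_nonpos_pos mult_nonneg_nonpos)
qed

lemma sinsq_over'_antimono:
  assumes "0 < u" "u \<le> v" "v \<le> pi / 2"
  shows "sinsq_over' v \<le> sinsq_over' u"
proof (rule DERIV_nonpos_imp_nonincreasing[OF \<open>u \<le> v\<close>])
  fix x assume "u \<le> x" "x \<le> v"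
  then show "\<exists>y. (sinsq_over' has_real_derivative y) (at x) \<and> y \<le> 0"
    using assms DERIV_sinsq_over'[of x] sinsq_over''_nonpos[of x] by auto
qed

lemma sinsq_over'_pos:
  assumes "0 < u" "u \<le> pi / 2.7"
  shows "sinsq_over' u > 0"
proof -
  have "sin u > 0" using assms pi_approx by (intro sin_gt_zero) auto
  moreover have "2 * cos u - sin u / u > 0"
    using sin_less_2u_cos[OF assms] assms by (simp add: field_simps)
  moreover have "sinsq_over' u = (sin u / u) * (2 * cos u - sin u / u)"
    by (simp add: sinsq_over'_def power2_eq_square algebra_simps)
  ultimately show ?thesis using assms by simp
qed

text \<open>The difference 1 - \<open>sinsq_over' u\<close> is the sum of squares (sin u / u - cos
  u)^2 + (sin u)^2. This will make the derivative of \<open>S_fun\<close> negative at 0.\<close>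

lemma sinsq_over'_less_1:
  assumes "0 < u" "u < pi"
  shows "sinsq_over' u < 1"
proof -
  have "1 - sinsq_over' u = (sin u / u - cos u)\<^sup>2 + (sin u)\<^sup>2"
    unfolding sinsq_over'_def sin_squared_eq[of u] by (simp add: power2_eq_square algebra_simps)
  moreover have "(sin u)\<^sup>2 > 0" using sin_gt_zero[OF assms] by simp
  ultimately show ?thesis by (smt (verit) zero_le_power2)
qed

lemma tendsto_sinsq_over': "(sinsq_over' \<longlongrightarrow> 1) (at 0)"
proof -
  have "((\<lambda>u::real. sin u / u) \<longlongrightarrow> 1) (at 0)"
    using DERIV_sin[of "0::real"] by (simp add: DERIV_def)
  then have "((\<lambda>u. 2 * cos u * (sin u / u) - (sin u / u)\<^sup>2) \<longlongrightarrow> 2 * cos 0 * 1 - 1\<^sup>2) (at (0::real))"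
    by (intro tendsto_intros)
  then show ?thesis by (simp add: sinsq_over'_def[abs_def])
qed

text \<open>Up to pi/2 this is concavity. Beyond pi/2 the function is at most 1 / u, hence below its
  value 2 / pi at pi/2, while the tangent keeps rising because its slope is positive for
  \<open>v\<close> up to pi / 2.7.\<close>

lemma sinsq_over_le_tangent:
  assumes v: "0 < v" "v \<le> pi / 2.7" and u: "0 < u"
  shows "sinsq_over u \<le> sinsq_over v + sinsq_over' v * (u - v)"
proof -
  have v2: "v \<le> pi / 2" using v pi_approx by auto
  have tan: "sinsq_over x \<le> sinsq_over v + sinsq_over' v * (x - v)" if "0 < x" "x \<le> pi / 2" for x
  proof -
    have "- sinsq_over' v * (x - v) \<le> - sinsq_over x - - sinsq_over v"
    proof (rule f''_imp_f'[where C = "{0<..pi/2}" and f = "\<lambda>x. - sinsq_over x" and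
          f' = "\<lambda>x. - sinsq_over' x" and
          f'' = "\<lambda>u. - (2 * (u\<^sup>2 * cos (2 * u) - u * sin (2 * u) + (sin u)\<^sup>2) / u ^ 3)"])
      fix x assume x: "x \<in> {0<..pi/2}"
      then show "0 \<le> - (2 * (x\<^sup>2 * cos (2 * x) - x * sin (2 * x) + (sin x)\<^sup>2) / x ^ 3)"
        using sinsq_over''_nonpos[of x] by (simp only: greaterThanAtMost_iff neg_0_le_iff_le)
      show "((\<lambda>x. - sinsq_over x) has_real_derivative - sinsq_over' x) (at x)"
        using x by (intro DERIV_minus DERIV_sinsq_over) auto
      show "((\<lambda>x. - sinsq_over' x) has_real_derivative
          - (2 * (x\<^sup>2 * cos (2 * x) - x * sin (2 * x) + (sin x)\<^sup>2) / x ^ 3)) (at x)"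
        using x by (intro DERIV_minus DERIV_sinsq_over') auto
    qed (use that v v2 in auto)
    then show ?thesis by (simp add: algebra_simps)
  qed
  show ?thesis
  proof (cases "u \<le> pi / 2")
    case True
    with tan u show ?thesis by simp
  next
    case False
    have "(sin u)\<^sup>2 \<le> 1" by (simp add: abs_square_le_1)
    then have "sinsq_over u \<le> 1 / u" using u by (simp add: sinsq_over_def divide_right_mono)
    also have "\<dots> \<le> 1 / (pi / 2)" using False u by (intro divide_left_mono) auto
    also have "\<dots> = sinsq_over (pi / 2)" by (simp add: sinsq_over_def)
    also have "\<dots> \<le> sinsq_over v + sinsq_over' v * (pi / 2 - v)" by (rule tan) auto
    also have "\<dots> \<le> sinsq_over v + sinsq_over' v * (u - v)"
      using False sinsq_over'_pos[OF v] by (intro add_left_mono mult_left_mono) auto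
    finally show ?thesis .
  qed
qed

text \<open>Up to pi this is convexity, the second derivative being sin. Beyond pi the tangent has
  slope at most 0 and has already fallen below 0, whereas x / 2 - sin x is at least x / 2 - 1 and
  thus nonnegative.\<close>

lemma half_minus_sin_ge_tangent:
  fixes s x :: real
  assumes s: "0 \<le> s" "s \<le> pi / 3" and x: "0 \<le> x"
  shows "s / 2 - sin s + (1 / 2 - cos s) * (x - s) \<le> x / 2 - sin x"
proof -
  have tan: "(1 / 2 - cos s) * (y - s) \<le> (y / 2 - sin y) - (s / 2 - sin s)" if "0 \<le> y" "y \<le> pi" for y
  proof (rule f''_imp_f'[where C = "{0..pi}" and f'' = sin])
    fix z :: real assume z: "z \<in> {0..pi}"
    show "((\<lambda>y. y / 2 - sin y) has_real_derivative (1 / 2 - cos z)) (at z)"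
      by (auto intro!: derivative_eq_intros)
    show "((\<lambda>s. 1 / 2 - cos s) has_real_derivative sin z) (at z)"
      by (auto intro!: derivative_eq_intros)
    show "0 \<le> sin z" using z by (simp add: sin_ge_zero)
  qed (use s that in auto)
  show ?thesis
  proof (cases "x \<le> pi")
    case True
    with tan[of x] x show ?thesis by simp
  next
    case False
    have "cos (pi / 3) \<le> cos s" using s by (intro cos_monotone_0_pi_le) auto
    then have "1 / 2 \<le> cos s" by (simp add: cos_60)
    \<comment> \<open>The tangent is followed back to pi/3, the minimum of y / 2 - sin y on [0, pi],
      where convexity bounds it by pi/6 - sqrt 3 / 2, a negative number.\<close>
    then have "(1 / 2 - cos s) * (x - s) \<le> (1 / 2 - cos s) * (pi / 3 - s)"
      using False s(2) pi_gt_zero by (intro mult_left_mono_neg) linarith+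
    also have "\<dots> \<le> (pi / 3 / 2 - sin (pi / 3)) - (s / 2 - sin s)" by (rule tan) auto
    also have "pi / 3 / 2 - sin (pi / 3) \<le> 0"
    proof -
      have "sqrt 3 \<ge> 1.7" by (intro real_le_rsqrt) (auto simp: power2_eq_square)
      then show ?thesis using pi_approx by (simp add: sin_60)
    qed
    also have "0 \<le> x / 2 - 1" using False pi_ge_two by simp
    also have "\<dots> \<le> x / 2 - sin x" by simp
    finally show ?thesis by simp
  qed
qed

section \<open>Optimality of the equidistant nodes\<close>

text \<open>\<open>4 \<pi>\<^sup>2 k\<^sup>2\<close> times the squared radius.\<close>
definition radicand :: "real \<Rightarrow> nat \<Rightarrow> (nat \<Rightarrow> real) \<Rightarrow> real" where
  "radicand k n x = gap n x 0 - sin (2 * pi * k * gap n x 0) / (pi * k)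
                  + gap n x n - sin (2 * pi * k * gap n x n) / (pi * k)
                  + 1 - 1 / (pi\<^sup>2 * k\<^sup>2)
                        * (\<Sum>j=1..n-1. (sin (pi * k * gap n x j))\<^sup>2 / gap n x j)"

text \<open>\<open>radicand\<close> and \<open>S_fun\<close> are even in \<open>k\<close>, so the
  optimisation can be carried out for positive \<open>k\<close> only.\<close>

lemma radicand_abs: "radicand \<bar>k\<bar> n x = radicand k n x"
  by (cases "k \<ge> 0") (simp_all add: radicand_def)

lemma S_fun_abs: "S_fun \<bar>k\<bar> n x = S_fun k n x"
  by (cases "k \<ge> 0") (simp_all add: S_fun_def)

lemma admissible_nodes_gap:
  assumes "admissible_nodes n x" "n \<ge> 1"
  shows "gap n x 0 \<ge> 0" "gap n x n \<ge> 0" "\<And>j. j \<in> {1..n-1} \<Longrightarrow> gap n x j > 0"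
    "gap n x 0 + gap n x n + (\<Sum>j=1..n-1. gap n x j) = 1"
proof -
  show "gap n x 0 \<ge> 0" "gap n x n \<ge> 0" using assms by (auto simp: admissible_nodes_def gap_def)
  show "gap n x j > 0" if "j \<in> {1..n-1}" for j
  proof -
    have "x j < x (j + 1)" using that assms
      by (intro strict_mono_onD[of "{1..n}" x]) (auto simp: admissible_nodes_def)
    then show ?thesis using that by (auto simp: gap_def)
  qed
  have "(\<Sum>j=1..n-1. gap n x j) = (\<Sum>j=1..<n. x (Suc j) - x j)"
    using assms by (intro sum.cong) (auto simp: gap_def)
  also have "\<dots> = x n - x 1" using assms(2) by (simp add: sum_Suc_diff')
  finally show "gap n x 0 + gap n x n + (\<Sum>j=1..n-1. gap n x j) = 1"
    using assms(2) by (simp add: gap_def)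
qed

text \<open>With \<open>u = \<pi> k (1 - 2 x) / (n - 1)\<close> the last summand of \<^term>\<open>S_fun\<close> is
  \<open>(n - 1) / (\<pi> k) * sin\<^sup>2 u / u\<close>.\<close>

definition S_fun' :: "real \<Rightarrow> nat \<Rightarrow> real \<Rightarrow> real" where
  "S_fun' k n x = 2 - 4 * cos (2 * pi * k * x) + 2 * sinsq_over' (pi * k * (1 - 2 * x) / (real n - 1))"

lemma S_fun_eq:
  assumes "k > 0" "real n > 1" "x \<noteq> 1/2"
  shows "S_fun k n x = 2 * x - 2 * sin (2 * pi * k * x) / (pi * k)
    - (real n - 1) / (pi * k) * sinsq_over (pi * k * (1 - 2 * x) / (real n - 1))"
  using assms by (simp add: S_fun_def sinsq_over_def power2_eq_square field_simps)

lemma DERIV_S_fun: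
  assumes "k > 0" "real n > 1" "x < 1/2"
  shows "(S_fun k n has_real_derivative S_fun' k n x) (at x)"
proof -
  let ?u = "\<lambda>x. pi * k * (1 - 2 * x) / (real n - 1)"
  have "?u x \<noteq> 0" using assms by auto
  then have "(sinsq_over has_real_derivative sinsq_over' (?u x)) (at (?u x))"
    by (rule DERIV_sinsq_over)
  moreover have "(?u has_real_derivative - (2 * (pi * k) / (real n - 1))) (at x)"
  proof -
    have "((\<lambda>x. pi * k * (1 - 2 * x)) has_real_derivative - (2 * (pi * k))) (at x)"
      by (auto intro!: derivative_eq_intros)
    from DERIV_cdivide[OF this, of "real n - 1"] show ?thesis by simp
  qed
  ultimately have 1: "((\<lambda>x. sinsq_over (?u x)) has_real_derivative
      sinsq_over' (?u x) * - (2 * (pi * k) / (real n - 1))) (at x)"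
    by (rule DERIV_chain2)
  have "((\<lambda>x. 2 * x - 2 * sin (2 * pi * k * x) / (pi * k)
    - (real n - 1) / (pi * k) * sinsq_over (?u x)) has_real_derivative S_fun' k n x) (at x)"
  proof -
    have "((\<lambda>x. sin (2 * pi * k * x)) has_real_derivative cos (2 * pi * k * x) * (2 * (pi * k))) (at x)"
      by (auto intro!: derivative_eq_intros)
    from DERIV_diff[OF DERIV_diff[OF DERIV_cmult[OF DERIV_ident, of 2]
          DERIV_cdivide[OF DERIV_cmult[OF this, of 2], of "pi * k"]]
        DERIV_cmult[OF 1, of "(real n - 1) / (pi * k)"]]
    have D: "((\<lambda>x. 2 * x - 2 * sin (2 * pi * k * x) / (pi * k) - (real n - 1) / (pi * k) * sinsq_over (?u x))
      has_real_derivative 2 * 1 - 2 * (cos (2 * pi * k * x) * (2 * (pi * k))) / (pi * k) -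
        (real n - 1) / (pi * k) * (sinsq_over' (?u x) * - (2 * (pi * k) / (real n - 1)))) (at x)" .
    have alg: "2 * 1 - 2 * (C * (2 * p)) / p - M / p * (s * - (2 * p / M)) = 2 - 4 * C + 2 * s"
      if "p \<noteq> 0" "M \<noteq> 0" for p M C s :: real
      using that by (simp add: field_simps)
    have "2 * 1 - 2 * (cos (2 * pi * k * x) * (2 * (pi * k))) / (pi * k) -
        (real n - 1) / (pi * k) * (sinsq_over' (?u x) * - (2 * (pi * k) / (real n - 1))) = S_fun' k n x"
      unfolding S_fun'_def by (rule alg) (use assms in auto)
    with D show ?thesis by (simp only:)
  qed
  then show ?thesis
  \<comment> \<open>The rewriting \<open>S_fun_eq\<close> is available away from 1/2; agreement in a
    neighbourhood of \<open>x\<close> is enough to transfer the derivative.\<close>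
  proof (rule DERIV_cong_ev[OF refl _ refl, THEN iffD1, rotated])
    have "eventually (\<lambda>y. y \<in> {..<1/2}) (nhds x)"
      using assms by (intro eventually_nhds_in_open) auto
    then show "eventually (\<lambda>x. 2 * x - 2 * sin (2 * pi * k * x) / (pi * k)
      - (real n - 1) / (pi * k) * sinsq_over (?u x) = S_fun k n x) (nhds x)"
      by eventually_elim (use assms in \<open>simp add: S_fun_eq\<close>)
  qed
qed

section \<open>The stationary point of S and the minimal radicand for positive k\<close>

context
  fixes k :: real and n :: nat
  assumes k: "k > 0" and n: "real n - 1 \<ge> 2.7 * k"
begin

lemma n_gt_1: "real n > 1" using k n by linarith

text \<open>The hypothesis on \<open>n\<close> is translated here into the range (0, pi / 2.7] on
  which the tangent inequality for \<open>sinsq_over\<close> is available.\<close>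

lemma S_fun_arg_bounds:
  assumes "0 \<le> x" "x < 1/2"
  shows "0 < pi * k * (1 - 2 * x) / (real n - 1)" "pi * k * (1 - 2 * x) / (real n - 1) \<le> pi / 2.7"
proof -
  show "0 < pi * k * (1 - 2 * x) / (real n - 1)" using assms k n_gt_1 by simp
  have "k * (1 - 2 * x) \<le> k * 1" using assms k by (intro mult_left_mono) auto
  also have "\<dots> \<le> (real n - 1) / 2.7" using n by simp
  finally have "pi * (k * (1 - 2 * x)) \<le> pi * ((real n - 1) / 2.7)" by (intro mult_left_mono) auto
  then show "pi * k * (1 - 2 * x) / (real n - 1) \<le> pi / 2.7" using n_gt_1 by (simp add: field_simps)
qed

text \<open>The term -4 cos (2 pi k x) increases strictly, as its angle stays in [0, pi]. The other
  term does not decrease: its argument decreases with \<open>x\<close>, and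
  \<open>sinsq_over'\<close> is antitone.\<close>

lemma S_fun'_strict_mono:
  assumes "0 \<le> x" "x < y" "y < 1/2" "y \<le> 1 / (6 * k)"
  shows "S_fun' k n x < S_fun' k n y"
proof -
  have "k * y \<le> 1 / 6" using assms k by (simp add: field_simps)
  then have "pi * (2 * (k * y)) \<le> pi * 1" by (intro mult_left_mono) auto
  then have y: "2 * pi * k * y \<le> pi" by (simp add: mult_ac)
  then have "cos (2 * pi * k * y) < cos (2 * pi * k * x)"
    using assms k by (intro cos_monotone_0_pi) auto
  moreover have "sinsq_over' (pi * k * (1 - 2 * x) / (real n - 1)) \<le> sinsq_over' (pi * k * (1 - 2 * y) / (real n - 1))"
  proof (rule sinsq_over'_antimono)
    show "0 < pi * k * (1 - 2 * y) / (real n - 1)"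
      using assms by (intro S_fun_arg_bounds) auto
    show "pi * k * (1 - 2 * y) / (real n - 1) \<le> pi * k * (1 - 2 * x) / (real n - 1)"
      using assms k n_gt_1 by (intro divide_right_mono mult_left_mono) auto
    have "pi * k * (1 - 2 * x) / (real n - 1) \<le> pi / 2.7"
      using assms by (intro S_fun_arg_bounds) auto
    then show "pi * k * (1 - 2 * x) / (real n - 1) \<le> pi / 2" by (rule order_trans) simp
  qed
  ultimately show ?thesis by (simp add: S_fun'_def)
qed

text \<open>If 1 / (6 k) is the smaller end point, then the cosine there is 1/2 and only twice a
  positive value of \<open>sinsq_over'\<close> remains. Otherwise \<open>k\<close> is at most 1/3,
  and the limit of \<open>S_fun'\<close> at 1/2 is 4 - 4 cos (pi k), which is positive.\<close>

lemma S_fun'_pos_near_right: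
  obtains r where "0 < r" "r < 1/2" "r \<le> 1 / (6 * k)" "S_fun' k n r > 0"
proof (cases "1 / (6 * k) < 1/2")
  case True
  have "2 * pi * k * (1 / (6 * k)) = pi / 3" using k by simp
  then have "S_fun' k n (1 / (6 * k)) > 0"
    using sinsq_over'_pos[OF S_fun_arg_bounds[of "1 / (6 * k)"]] True k
    by (simp add: S_fun'_def cos_60)
  with that[of "1 / (6 * k)"] True k show ?thesis by auto
next
  case False
  then have k3: "k \<le> 1/3" using k by (simp add: field_simps)
  let ?u = "\<lambda>x. pi * k * (1 - 2 * x) / (real n - 1)"
  \<comment> \<open>At 1/2 itself division by zero yields \<open>sinsq_over' 0 = 0\<close> instead
    of the limit 1. Hence a point \<open>r\<close> slightly to the left of 1/2 is produced from the
    one-sided limit.\<close>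
  have "(?u \<longlongrightarrow> pi * k * (1 - 2 * (1/2)) / (real n - 1)) (at_left (1/2))"
    using n_gt_1 by (intro tendsto_intros) auto
  moreover have "eventually (\<lambda>x. ?u x \<noteq> 0) (at_left (1/2))"
    using k n_gt_1 by (auto simp: eventually_at_filter)
  ultimately have "filterlim ?u (at 0) (at_left (1/2))"
    by (intro filterlim_atI) auto
  then have "((\<lambda>x. sinsq_over' (?u x)) \<longlongrightarrow> 1) (at_left (1/2))"
    by (rule filterlim_compose[OF tendsto_sinsq_over'])
  then have "(S_fun' k n \<longlongrightarrow> 2 - 4 * cos (2 * pi * k * (1/2)) + 2 * 1) (at_left (1/2))"
    unfolding S_fun'_def[abs_def] by (intro tendsto_intros)
  moreover have "cos (2 * pi * k * (1/2)) < cos 0"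
  proof (rule cos_monotone_0_pi)
    have "pi * k \<le> pi * 1" using k3 by (intro mult_left_mono) auto
    then show "2 * pi * k * (1/2) \<le> pi" by simp
  qed (use k in auto)
  ultimately have "eventually (\<lambda>x. S_fun' k n x > 0) (at_left (1/2))"
    by (intro order_tendstoD(1)) auto
  moreover have "eventually (\<lambda>x. x \<in> {0<..<1/2::real}) (at_left (1/2))"
    by (intro eventually_at_leftI[of 0]) auto
  ultimately have "eventually (\<lambda>x. S_fun' k n x > 0 \<and> x \<in> {0<..<1/2}) (at_left (1/2))"
    by eventually_elim auto
  from eventually_happens'[OF trivial_limit_at_left_real this]
  obtain r where "S_fun' k n r > 0" "0 < r" "r < 1/2" by auto
  moreover from this False have "r \<le> 1 / (6 * k)" by linarith
  ultimately show ?thesis using that by simp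
qed

lemma stationary_point_S_fun_iff:
  assumes "x < 1/2"
  shows "stationary_point (S_fun k n) x \<longleftrightarrow> S_fun' k n x = 0"
  using DERIV_S_fun[OF k n_gt_1 assms] DERIV_unique unfolding stationary_point_def by metis

text \<open>The derivative is negative at 0, since it equals -2 plus twice a value of
  \<open>sinsq_over'\<close>, which is below 1. It is positive at some \<open>r\<close> inside the
  range and strictly increasing, so it has exactly one zero.\<close>

lemma ex1_stationary_point_S_fun:
  "\<exists>!t. t \<in> {0<..<min (1/2) (1 / (6 * k))} \<and> stationary_point (S_fun k n) t"
proof -
  obtain r where r: "0 < r" "r < 1/2" "r \<le> 1 / (6 * k)" "S_fun' k n r > 0"
    by (rule S_fun'_pos_near_right)
  have neg: "S_fun' k n 0 < 0"
  proof -
    have A: "0 < pi * k * (1 - 2 * 0) / (real n - 1)" by (rule S_fun_arg_bounds(1)) auto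
    have "pi * k * (1 - 2 * 0) / (real n - 1) \<le> pi / 2.7" by (rule S_fun_arg_bounds(2)) auto
    also have "\<dots> < pi" by simp
    finally have "sinsq_over' (pi * k * (1 - 2 * 0) / (real n - 1)) < 1"
      by (rule sinsq_over'_less_1[OF A])
    then show ?thesis by (simp add: S_fun'_def)
  qed
  have "continuous_on {0..r} (S_fun' k n)"
    unfolding S_fun'_def[abs_def] sinsq_over'_def
    using r k n_gt_1 by (intro continuous_intros) auto
  then obtain t where t: "0 \<le> t" "t \<le> r" "S_fun' k n t = 0"
    using IVT'[of "S_fun' k n" 0 0 r] neg r by auto
  with neg r have t': "0 < t" "t < r" by (auto simp: order_le_less)
  show ?thesis
  proof (rule ex1I[of _ t])
    show "t \<in> {0<..<min (1/2) (1 / (6 * k))} \<and> stationary_point (S_fun k n) t"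
      using t t' r by (simp add: stationary_point_S_fun_iff)
  next
    fix s assume s: "s \<in> {0<..<min (1/2) (1 / (6 * k))} \<and> stationary_point (S_fun k n) s"
    then have s': "0 < s" "s < 1/2" "s \<le> 1 / (6 * k)" and "stationary_point (S_fun k n) s" by auto
    then have S: "S_fun' k n s = S_fun' k n t" using t(3) by (simp add: stationary_point_S_fun_iff)
    have tr: "t < 1/2" "t \<le> 1 / (6 * k)" using t' r by linarith+
    show "s = t"
    proof (cases s t rule: linorder_cases)
      case less
      have "S_fun' k n s < S_fun' k n t"
        by (rule S_fun'_strict_mono) (use less s' tr in linarith)+
      with S show ?thesis by simp
    next
      case greater
      have "S_fun' k n t < S_fun' k n s"
        by (rule S_fun'_strict_mono) (use greater t' s' in linarith)+
      with S show ?thesis by simp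
    qed simp
  qed
qed

text \<open>The tangent inequalities hold at arbitrary gaps of the competitor \<open>y\<close>.
  Since all gaps add up to 1, their linear terms combine into one multiple of
  \<open>gap n y 0 + gap n y n - 2 * t\<close>, and its coefficient is half the derivative of
  \<open>S_fun\<close> at \<open>t\<close>.\<close>

lemma radicand_le:
  assumes t: "t \<in> {0<..<min (1/2) (1 / (6 * k))}" "stationary_point (S_fun k n) t"
    and x: "gap n x 0 = t" "gap n x n = t" "\<And>j. j \<in> {1..n-1} \<Longrightarrow> gap n x j = (1 - 2 * t) / (real n - 1)"
    and y: "admissible_nodes n y"
  shows "radicand k n x \<le> radicand k n y"
proof -
  have n1: "n \<ge> 1" using n_gt_1 by simp
  note gy = admissible_nodes_gap[OF y n1]
  define u where "u = pi * k * (1 - 2 * t) / (real n - 1)"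
  define M where "M = real n - 1"
  have M: "M > 0" "real (n - 1) = M" using n_gt_1 n1 by (auto simp: M_def)
  have u: "0 < u" "u \<le> pi / 2.7" unfolding u_def using S_fun_arg_bounds[of t] t by auto
  have crit: "1 - 2 * cos (2 * pi * k * t) + sinsq_over' u = 0"
    using t by (simp add: stationary_point_S_fun_iff S_fun'_def u_def)
  define \<phi> where "\<phi> a = a - sin (2 * pi * k * a) / (pi * k)" for a
  have \<phi>: "\<phi> t + (1 - 2 * cos (2 * pi * k * t)) * (a - t) \<le> \<phi> a" if "a \<ge> 0" for a
  proof -
    \<comment> \<open>Because \<open>t\<close> is below 1 / (6 k), the base point 2 pi k t of the
      tangent is at most pi/3. Division by pi k then turns the tangent of y / 2 - sin y into that of
      \<phi>.\<close>
    have "t * (6 * k) \<le> 1" using t k by (simp add: field_simps)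
    then have "2 * pi * k * t / 2 - sin (2 * pi * k * t) + (1 / 2 - cos (2 * pi * k * t)) * (2 * pi * k * a - 2 * pi * k * t)
      \<le> 2 * pi * k * a / 2 - sin (2 * pi * k * a)"
      using k t that by (intro half_minus_sin_ge_tangent) (auto simp: field_simps)
    then have "(2 * pi * k * t / 2 - sin (2 * pi * k * t) + (1 / 2 - cos (2 * pi * k * t)) * (2 * pi * k * a - 2 * pi * k * t)) / (pi * k)
      \<le> (2 * pi * k * a / 2 - sin (2 * pi * k * a)) / (pi * k)"
      using k by (intro divide_right_mono) auto
    then show ?thesis using k by (simp add: \<phi>_def diff_divide_distrib add_divide_distrib algebra_simps)
  qed
  have sq: "1 / (pi\<^sup>2 * k\<^sup>2) * (\<Sum>j=1..n-1. (sin (pi * k * gap n z j))\<^sup>2 / gap n z j)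
    = (\<Sum>j=1..n-1. sinsq_over (pi * k * gap n z j)) / (pi * k)" for z
    using k by (simp add: sum_distrib_left sum_divide_distrib sinsq_over_def power2_eq_square field_simps)
  have "(\<Sum>j=1..n-1. sinsq_over (pi * k * gap n y j))
    \<le> (\<Sum>j=1..n-1. sinsq_over u + sinsq_over' u * (pi * k * gap n y j - u))"
    using gy(3) k by (intro sum_mono sinsq_over_le_tangent u) auto
  also have "\<dots> = M * sinsq_over u + sinsq_over' u * (pi * k * (\<Sum>j=1..n-1. gap n y j) - M * u)"
    using M by (simp add: sum.distrib sum_subtractf flip: sum_distrib_left)
  also have "pi * k * (\<Sum>j=1..n-1. gap n y j) - M * u
      = pi * k * (2 * t - gap n y 0 - gap n y n)"
  proof -
    have 1: "(\<Sum>j=1..n-1. gap n y j) = 1 - gap n y 0 - gap n y n" using gy(4) by linarith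
    have 2: "M * u = pi * k * (1 - 2 * t)" using M by (simp add: u_def M_def)
    show ?thesis unfolding 1 2 by (simp add: algebra_simps)
  qed
  finally have "(\<Sum>j=1..n-1. sinsq_over (pi * k * gap n y j)) / (pi * k)
      \<le> (M * sinsq_over u + sinsq_over' u * (pi * k * (2 * t - gap n y 0 - gap n y n))) / (pi * k)"
    using k by (intro divide_right_mono) auto
  also have "\<dots> = M * sinsq_over u / (pi * k) + sinsq_over' u * (2 * t - gap n y 0 - gap n y n)"
    using k by (simp add: add_divide_distrib)
  finally have S: "(\<Sum>j=1..n-1. sinsq_over (pi * k * gap n y j)) / (pi * k) \<le> \<dots>" .
  have "radicand k n x = 2 * \<phi> t + 1 - M * sinsq_over u / (pi * k)"
    unfolding radicand_def sq using M by (simp add: x \<phi>_def u_def M_def)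
  \<comment> \<open>The added product is zero by \<open>crit\<close>; it contributes exactly the
    linear terms that the two boundary tangents and the inner tangents require.\<close>
  also have "\<dots> \<le> 2 * \<phi> t + 1 - M * sinsq_over u / (pi * k)
      + (1 - 2 * cos (2 * pi * k * t) + sinsq_over' u) * (gap n y 0 + gap n y n - 2 * t)"
    by (simp add: crit)
  also have "\<dots> \<le> \<phi> (gap n y 0) + \<phi> (gap n y n) + 1 - (\<Sum>j=1..n-1. sinsq_over (pi * k * gap n y j)) / (pi * k)"
    using \<phi>[OF gy(1)] \<phi>[OF gy(2)] S by (simp add: algebra_simps)
  also have "\<dots> = radicand k n y"
    unfolding radicand_def sq by (simp add: \<phi>_def)
  finally show ?thesis .
qed

end

section \<open>The weight and its primitive\<close>

lemma has_integral_partition: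
  fixes y :: "nat \<Rightarrow> real" and f :: "real \<Rightarrow> 'a::banach"
  assumes "\<And>j. j < N \<Longrightarrow> y j \<le> y (Suc j)"
    and "\<And>j. j < N \<Longrightarrow> (f has_integral I j) {y j..y (Suc j)}"
  shows "(f has_integral (\<Sum>j<N. I j)) {y 0..y N}"
proof -
  have "y 0 \<le> y m \<and> (f has_integral (\<Sum>j<m. I j)) {y 0..y m}" if "m \<le> N" for m
    using that
  proof (induction m)
    case 0
    then show ?case by (simp add: has_integral_refl)
  next
    case (Suc m)
    then have "y 0 \<le> y m" "(f has_integral (\<Sum>j<m. I j)) {y 0..y m}"
      "y m \<le> y (Suc m)" "(f has_integral I m) {y m..y (Suc m)}"
      using assms by auto
    then show ?case
      using has_integral_combine[of "y 0" "y m" "y (Suc m)" f] by auto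
  qed
  then show ?thesis by blast
qed

lemma rho_eq_cis: "rho k x = cis (- (2 * pi * k * x))"
  by (simp add: rho_def cis_conv_exp mult_ac)

lemma cmod_rho [simp]: "cmod (rho k x) = 1"
  by (simp add: rho_eq_cis)

lemma cmod_rho_diff: "(cmod (rho k t - rho k s))\<^sup>2 = 2 - 2 * cos (2 * pi * k * (t - s))"
proof -
  have "(cmod (cis a - cis b))\<^sup>2 = 2 - 2 * cos (a - b)" for a b
    using sin_cos_squared_add[of a] sin_cos_squared_add[of b]
    unfolding cmod_power2 cos_diff by (simp add: power2_eq_square algebra_simps)
  from this[of "- (2 * pi * k * t)" "- (2 * pi * k * s)"]
  have "(cmod (rho k t - rho k s))\<^sup>2 = 2 - 2 * cos (2 * pi * k * s - 2 * pi * k * t)"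
    by (simp add: rho_eq_cis)
  also have "2 * pi * k * s - 2 * pi * k * t = - (2 * pi * k * (t - s))"
    by (simp add: algebra_simps)
  finally show ?thesis by simp
qed

text \<open>Among the primitives of \<open>rho k\<close> this one is a multiple of
  \<open>rho k\<close> itself. It therefore has constant modulus 1 / (2 pi |k|) and is easily
  integrated once more.\<close>

definition rho_primitive :: "real \<Rightarrow> real \<Rightarrow> complex" where
  "rho_primitive k x = \<i> * rho k x / (2 * pi * k)"

lemma has_vector_derivative_rho:
  "(rho k has_vector_derivative - (2 * pi * k * \<i>) * rho k x) (at x within S)"
proof -
  have "((\<lambda>z. exp (- 2 * complex_of_real pi * \<i> * complex_of_real k * z)) has_field_derivative
      - (2 * pi * k * \<i>) * rho k x) (at (of_real x))"
    unfolding rho_def by (auto intro!: derivative_eq_intros)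
  from has_vector_derivative_real_field[OF this]
  show ?thesis by (simp add: rho_def[abs_def] o_def)
qed

lemma has_vector_derivative_rho_primitive:
  assumes "k \<noteq> 0"
  shows "(rho_primitive k has_vector_derivative rho k x) (at x within S)"
proof -
  have "((\<lambda>x. \<i> / (2 * pi * k) * rho k x) has_vector_derivative
     \<i> / (2 * pi * k) * (- (2 * pi * k * \<i>) * rho k x)) (at x within S)"
    by (intro has_vector_derivative_mult_right has_vector_derivative_rho)
  then show ?thesis
    using assms by (simp add: rho_primitive_def[abs_def] mult.assoc)
qed

lemma continuous_on_rho: "continuous_on S (rho k)"
  by (rule continuous_on_vector_derivative[OF has_vector_derivative_rho])

lemma continuous_on_rho_primitive: "continuous_on S (rho_primitive k)"
proof -
  have "rho_primitive k = (\<lambda>x. \<i> / (2 * pi * k) * rho k x)"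
    by (simp add: rho_primitive_def fun_eq_iff)
  then show ?thesis
    by (simp only:) (intro continuous_on_mult continuous_on_const continuous_on_rho)
qed

lemma cmod_rho_primitive: "cmod (rho_primitive k x) = 1 / (2 * pi * \<bar>k\<bar>)"
  by (simp add: rho_primitive_def norm_divide norm_mult)

lemma cmod_rho_primitive_diff:
  "(cmod (rho_primitive k t - rho_primitive k s))\<^sup>2
    = (2 - 2 * cos (2 * pi * k * (t - s))) / (4 * pi\<^sup>2 * k\<^sup>2)"
proof -
  have "rho_primitive k t - rho_primitive k s = (rho k t - rho k s) * (\<i> / (2 * pi * k))"
    by (simp add: rho_primitive_def algebra_simps diff_divide_distrib)
  then have "cmod (rho_primitive k t - rho_primitive k s) = cmod (rho k t - rho k s) / (2 * pi * \<bar>k\<bar>)"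
    by (simp add: norm_mult norm_divide)
  then show ?thesis
    by (simp add: power_divide cmod_rho_diff power_mult_distrib)
qed

lemma has_integral_rho_primitive:
  assumes "k \<noteq> 0" "a \<le> b"
  shows "(rho_primitive k has_integral
    \<i> / (2 * pi * k) * (rho_primitive k b - rho_primitive k a)) {a..b}"
proof -
  have "((\<lambda>x. \<i> / (2 * pi * k) * rho_primitive k x) has_vector_derivative \<i> / (2 * pi * k) * rho k x) (at x within {a..b})" for x
    by (intro has_vector_derivative_mult_right has_vector_derivative_rho_primitive assms)
  then have "((\<lambda>x. \<i> / (2 * pi * k) * rho k x) has_integral
      \<i> / (2 * pi * k) * rho_primitive k b - \<i> / (2 * pi * k) * rho_primitive k a) {a..b}"
    by (intro fundamental_theorem_of_calculus assms)
  then show ?thesis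
    by (simp add: rho_primitive_def[abs_def] algebra_simps)
qed

text \<open>Applied with \<open>s = 0\<close> and \<open>s = 1\<close> on the two boundary
  intervals, where the subtracted constant is the value of the primitive at an end point of
  [0, 1].\<close>

lemma has_integral_square_end:
  assumes "k \<noteq> 0" "a \<le> b"
  shows "((\<lambda>t. (cmod (rho_primitive k t - rho_primitive k s))\<^sup>2) has_integral
    (2 * (b - a) - (sin (2 * pi * k * (b - s)) - sin (2 * pi * k * (a - s))) / (pi * k)) / (4 * pi\<^sup>2 * k\<^sup>2)) {a..b}"
proof -
  let ?F = "\<lambda>t. (2 * t - sin (2 * pi * k * (t - s)) / (pi * k)) / (4 * pi\<^sup>2 * k\<^sup>2)"
  have "(?F has_real_derivative (cmod (rho_primitive k t - rho_primitive k s))\<^sup>2) (at t within {a..b})" for t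
  proof -
    have "((\<lambda>t. sin (2 * pi * k * (t - s))) has_real_derivative cos (2 * pi * k * (t - s)) * (2 * pi * k)) (at t within {a..b})"
      by (auto intro!: derivative_eq_intros)
    from DERIV_cdivide[OF DERIV_diff[OF DERIV_cmult[OF DERIV_ident, of 2] DERIV_cdivide[OF this, of "pi * k"]],
        of "4 * pi\<^sup>2 * k\<^sup>2"]
    show ?thesis
      by (rule DERIV_cong) (use assms in \<open>simp add: cmod_rho_primitive_diff\<close>)
  qed
  then have "((\<lambda>t. (cmod (rho_primitive k t - rho_primitive k s))\<^sup>2) has_integral ?F b - ?F a) {a..b}"
    using assms by (intro fundamental_theorem_of_calculus) (auto simp: has_real_derivative_iff_has_vector_derivative)
  moreover have "?F b - ?F a = (2 * (b - a) - (sin (2 * pi * k * (b - s)) - sin (2 * pi * k * (a - s))) / (pi * k)) / (4 * pi\<^sup>2 * k\<^sup>2)"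
    unfolding diff_divide_distrib[symmetric] by (simp add: algebra_simps diff_divide_distrib)
  ultimately show ?thesis by simp
qed

text \<open>This is a variance: with M the integral of P and L the length of the interval, the
  integral of |P - c|^2 is that of |P|^2 minus |M|^2 / L. The modulus of P is constant, and M is a
  multiple of an increment of P, whose squared modulus is a multiple of sin^2 (pi k L).\<close>

lemma has_integral_square_mean:
  assumes "k \<noteq> 0" "a < b"
  defines "c \<equiv> integral {a..b} (rho_primitive k) / (b - a)"
  shows "((\<lambda>t. (cmod (rho_primitive k t - c))\<^sup>2) has_integral
    ((b - a) - (sin (pi * k * (b - a)))\<^sup>2 / (pi\<^sup>2 * k\<^sup>2 * (b - a))) / (4 * pi\<^sup>2 * k\<^sup>2)) {a..b}"
proof -
  let ?P = "rho_primitive k"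
  define M where "M = integral {a..b} ?P"
  define L where "L = b - a"
  have L: "L > 0" using assms by (simp add: L_def)
  have cM: "c = M / L" by (simp add: c_def M_def L_def)
  have iP: "(?P has_integral \<i> / (2 * pi * k) * (?P b - ?P a)) {a..b}"
    using assms by (intro has_integral_rho_primitive) auto
  then have M: "M = \<i> / (2 * pi * k) * (?P b - ?P a)" by (simp add: M_def integral_unique)
  have PM: "(?P has_integral M) {a..b}" using iP M by simp
  have "(cmod M)\<^sup>2 = (cmod (?P b - ?P a))\<^sup>2 / (4 * pi\<^sup>2 * k\<^sup>2)"
    by (simp add: M norm_mult norm_divide power_divide power_mult_distrib)
  also have "\<dots> = (2 - 2 * cos (2 * pi * k * L)) / (4 * pi\<^sup>2 * k\<^sup>2) / (4 * pi\<^sup>2 * k\<^sup>2)"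
    by (simp add: cmod_rho_primitive_diff L_def)
  also have "2 - 2 * cos (2 * pi * k * L) = 4 * (sin (pi * k * L))\<^sup>2"
    using cos_double_sin[of "pi * k * L"] by (simp add: mult_ac)
  finally have M2: "(cmod M)\<^sup>2 = (sin (pi * k * L))\<^sup>2 / (pi\<^sup>2 * k\<^sup>2) / (4 * pi\<^sup>2 * k\<^sup>2)"
    by simp
  have sq: "(cmod (?P t - c))\<^sup>2 = 1 / (4 * pi\<^sup>2 * k\<^sup>2) + (cmod c)\<^sup>2 - 2 * Re (cnj c * ?P t)" for t
  proof -
    have "(cmod (?P t - c))\<^sup>2 = (cmod (?P t))\<^sup>2 + (cmod c)\<^sup>2 - 2 * Re (cnj c * ?P t)"
      unfolding cmod_power2 by (simp add: power2_eq_square algebra_simps)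
    then show ?thesis by (simp add: cmod_rho_primitive power_divide power_mult_distrib)
  qed
  have "((\<lambda>t. Re (cnj c * ?P t)) has_integral Re (cnj c * M)) {a..b}"
    using has_integral_linear[OF has_integral_mult_right[OF PM, of "cnj c"] bounded_linear_Re]
    by (simp add: o_def)
  moreover have "((\<lambda>t. 1 / (4 * pi\<^sup>2 * k\<^sup>2) + (cmod c)\<^sup>2) has_integral
      (b - a) *\<^sub>R (1 / (4 * pi\<^sup>2 * k\<^sup>2) + (cmod c)\<^sup>2)) {a..b}"
    using has_integral_const_real[of "1 / (4 * pi\<^sup>2 * k\<^sup>2) + (cmod c)\<^sup>2" a b] assms(2) by simp
  ultimately have "((\<lambda>t. (cmod (?P t - c))\<^sup>2) has_integral
      (b - a) *\<^sub>R (1 / (4 * pi\<^sup>2 * k\<^sup>2) + (cmod c)\<^sup>2) - 2 * Re (cnj c * M)) {a..b}"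
    unfolding sq by (intro has_integral_diff has_integral_mult_right)
  moreover have "(b - a) *\<^sub>R (1 / (4 * pi\<^sup>2 * k\<^sup>2) + (cmod c)\<^sup>2) - 2 * Re (cnj c * M)
      = L / (4 * pi\<^sup>2 * k\<^sup>2) - (cmod M)\<^sup>2 / L"
  proof -
    have "Re (cnj c * M) = (cmod M)\<^sup>2 / L"
      unfolding cM cmod_power2 by (simp add: power2_eq_square add_divide_distrib)
    moreover have "L * (cmod c)\<^sup>2 = (cmod M)\<^sup>2 / L"
      using L by (simp add: cM norm_divide power_divide power2_eq_square)
    ultimately show ?thesis by (simp add: L_def algebra_simps)
  qed
  moreover have "L / (4 * pi\<^sup>2 * k\<^sup>2) - (cmod M)\<^sup>2 / L
      = (L - (sin (pi * k * L))\<^sup>2 / (pi\<^sup>2 * k\<^sup>2 * L)) / (4 * pi\<^sup>2 * k\<^sup>2)"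
    unfolding M2 by (simp add: diff_divide_distrib mult_ac)
  ultimately show ?thesis by (simp add: L_def)
qed

section \<open>The kernel of the integral functional\<close>

text \<open>In the notation of the introduction, \<open>kernel\<close> is \<open>P - c\<close>.\<close>

definition partition_point :: "nat \<Rightarrow> (nat \<Rightarrow> real) \<Rightarrow> nat \<Rightarrow> real" where
  "partition_point n x j = (if j = 0 then 0 else if j \<le> n then x j else 1)"

text \<open>The end points 0 and 1 need not be nodes, so on the boundary intervals P - c itself has
  to vanish there. On inner intervals every constant would remove the boundary terms, and the mean
  minimises the L2 norm.\<close>

definition kernel_const :: "real \<Rightarrow> nat \<Rightarrow> (nat \<Rightarrow> real) \<Rightarrow> nat \<Rightarrow> complex" where
  "kernel_const k n x j = (if j = 0 then rho_primitive k 0 else if j = n then rho_primitive k 1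
     else integral {x j..x (Suc j)} (rho_primitive k) / (x (Suc j) - x j))"

text \<open>For admissible nodes the half-open intervals count every point of [0, 1) once. A single
  formula with indicators makes measurability and boundedness immediate; the values at the break
  points do not affect any integral.\<close>

definition kernel :: "real \<Rightarrow> nat \<Rightarrow> (nat \<Rightarrow> real) \<Rightarrow> real \<Rightarrow> complex" where
  "kernel k n x t = rho_primitive k t
     - (\<Sum>j\<le>n. indicator {partition_point n x j..<partition_point n x (Suc j)} t * kernel_const k n x j)"

lemma borel_measurable_kernel [measurable]: "kernel k n x \<in> borel_measurable borel"
proof -
  have [measurable]: "rho_primitive k \<in> borel_measurable borel"
    by (intro borel_measurable_continuous_onI continuous_on_rho_primitive)
  show ?thesis unfolding kernel_def[abs_def] by measurable
qed

lemma kernel_bounded: "\<exists>B>0. \<forall>t. cmod (kernel k n x t) \<le> B"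
proof (intro exI conjI allI)
  let ?B = "1 / (2 * pi * \<bar>k\<bar>) + (\<Sum>j\<le>n. cmod (kernel_const k n x j)) + 1"
  have "(\<Sum>j\<le>n. cmod (kernel_const k n x j)) \<ge> 0" by (intro sum_nonneg) auto
  then show "?B > 0" by (intro add_nonneg_pos add_nonneg_nonneg) auto
  fix t
  have "cmod (\<Sum>j\<le>n. indicator {partition_point n x j..<partition_point n x (Suc j)} t * kernel_const k n x j)
     \<le> (\<Sum>j\<le>n. cmod (kernel_const k n x j))"
    by (intro sum_norm_le) (simp add: norm_mult indicator_def)
  then show "cmod (kernel k n x t) \<le> ?B"
    unfolding kernel_def using cmod_rho_primitive[of k t]
    by (intro order_trans[OF norm_triangle_ineq4]) linarith
qed

section \<open>Measurability and integrability on the unit interval\<close>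

lemma borel_measurable_lebesgue_onI:
  "f \<in> borel_measurable borel \<Longrightarrow> f \<in> borel_measurable (lebesgue_on S)"
  by (intro measurable_restrict_space1 measurable_completion) simp

lemma integrable_lebesgue_on_bounded:
  fixes f :: "real \<Rightarrow> 'b::{banach, second_countable_topology}"
  assumes "f \<in> borel_measurable (lebesgue_on {a..b})" "\<And>t. norm (f t) \<le> B"
  shows "integrable (lebesgue_on {a..b}) f"
  using assms by (intro finite_measure.integrable_const_bound[of _ _ B] finite_measure_lebesgue_on) auto

lemma AE_lebesgue_on_negligible:
  assumes "S \<in> sets lebesgue" "AE x in lebesgue_on S. P x"
  obtains N where "negligible N" "\<And>x. x \<in> S - N \<Longrightarrow> P x"
proof -
  from assms(2) obtain N where N: "{x \<in> space (lebesgue_on S). \<not> P x} \<subseteq> N" "N \<in> null_sets (lebesgue_on S)"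
    by (auto simp: eventually_ae_filter)
  have "N \<in> null_sets lebesgue"
    using N(2) assms(1) by (simp add: null_sets_restrict_space)
  with N(1) show thesis
    by (intro that[of N]) (auto simp: negligible_iff_null_sets)
qed

text \<open>L2 is contained in L1 on a set of finite measure, by the pointwise bound y \<le> 1 +
  y^2.\<close>

lemma integrable_deriv01:
  assumes "f \<in> H1"
  shows "integrable (lebesgue_on {0..1}) (deriv01 f)"
proof (rule Bochner_Integration.integrable_bound)
  show "integrable (lebesgue_on {0..1}) (\<lambda>x. 1 + (cmod (deriv01 f x))\<^sup>2)"
    using assms by (intro Bochner_Integration.integrable_add) (auto simp: H1_def)
  show "deriv01 f \<in> borel_measurable (lebesgue_on {0..1})" using assms by (simp add: H1_def)
  have "y \<le> 1 + y\<^sup>2" for y :: real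
    using zero_le_power2[of "y - 1/2"] by (simp add: power2_eq_square algebra_simps)
  then show "AE x in lebesgue_on {0..1}. norm (deriv01 f x) \<le> norm (1 + (cmod (deriv01 f x))\<^sup>2)"
    by (intro AE_I2) (simp add: abs_of_nonneg)
qed

lemma lipschitz_rho_primitive:
  assumes "k \<noteq> 0" "s \<le> t"
  shows "cmod (rho_primitive k t - rho_primitive k s) \<le> 1 * (t - s)"
proof -
  have "(rho k has_integral rho_primitive k t - rho_primitive k s) {s..t}"
    by (intro fundamental_theorem_of_calculus assms has_vector_derivative_rho_primitive)
  from has_integral_bound_real[OF _ finite.emptyI this, of 1]
  have "cmod (rho_primitive k t - rho_primitive k s) \<le> 1 * measure lborel {s..t}"
    by simp
  then show ?thesis using assms by simp
qed

lemma information_eq_replicate_0_iff: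
  "information n x f = replicate n 0 \<longleftrightarrow> (\<forall>j\<in>{1..n}. f (x j) = 0)"
proof
  assume "information n x f = replicate n 0"
  then have "set (information n x f) \<subseteq> {0}" by auto
  moreover have "f (x j) \<in> set (information n x f)" if "j \<in> {1..n}" for j
    unfolding information_def set_map by (rule imageI) (use that in auto)
  ultimately show "\<forall>j\<in>{1..n}. f (x j) = 0" by blast
next
  assume "\<forall>j\<in>{1..n}. f (x j) = 0"
  then show "information n x f = replicate n 0"
    by (intro replicate_eqI) (auto simp: information_def)
qed

section \<open>The kernel for fixed nodes: its L2 norm and the upper bound for the radius\<close>

context
  fixes k :: real and n :: nat and x :: "nat \<Rightarrow> real"
  assumes k: "k \<noteq> 0" and n: "n \<ge> 1" and adm: "admissible_nodes n x"
begin

abbreviation "pt \<equiv> partition_point n x"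
abbreviation "cst \<equiv> kernel_const k n x"
abbreviation "ker \<equiv> kernel k n x"

lemma partition_point_Suc_diff: "j \<le> n \<Longrightarrow> pt (Suc j) - pt j = gap n x j"
  using n by (auto simp: partition_point_def gap_def)

lemma gap_nonneg: "j \<le> n \<Longrightarrow> gap n x j \<ge> 0"
  using admissible_nodes_gap[OF adm n] by (cases "j = 0 \<or> j = n") (auto simp: less_imp_le)

lemma partition_point_mono:
  assumes "i \<le> j" "j \<le> Suc n"
  shows "pt i \<le> pt j"
  using assms
proof (induction rule: dec_induct)
  case (step m)
  then have "pt m \<le> pt (Suc m)"
    using partition_point_Suc_diff[of m] gap_nonneg[of m] by simp
  with step show ?case by simp
qed simp

lemma partition_point_ends: "pt 0 = 0" "pt (Suc n) = 1"
  by (auto simp: partition_point_def)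

lemma partition_point_bounds: "j \<le> Suc n \<Longrightarrow> 0 \<le> pt j \<and> pt j \<le> 1"
  using partition_point_mono[of 0 j] partition_point_mono[of j "Suc n"] partition_point_ends by simp

lemma kernel_eq:
  assumes "j \<le> n" "t \<in> {pt j<..<pt (Suc j)}"
  shows "ker t = rho_primitive k t - cst j"
proof -
  have ind: "indicator {pt i..<pt (Suc i)} t = (if i = j then 1 else 0 :: complex)" if "i \<le> n" for i
  proof (cases i j rule: linorder_cases)
    case less
    then have "pt (Suc i) \<le> pt j" using assms by (intro partition_point_mono) auto
    with less assms show ?thesis by (auto simp: indicator_def)
  next
    case greater
    then have "pt (Suc j) \<le> pt i" using that by (intro partition_point_mono) auto
    with greater assms show ?thesis by (auto simp: indicator_def)
  qed (use assms in auto)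
  have "(\<Sum>i\<le>n. indicator {pt i..<pt (Suc i)} t * cst i) = (\<Sum>i\<le>n. if i = j then cst i else 0)"
  proof (rule sum.cong[OF refl])
    fix i assume "i \<in> {..n}"
    then have "i \<le> n" by simp
    then show "indicator {pt i..<pt (Suc i)} t * cst i = (if i = j then cst i else 0)"
      by (simp only: ind) simp
  qed
  also have "\<dots> = cst j" using assms by simp
  finally show ?thesis by (simp add: kernel_def)
qed

text \<open>The parameter \<open>F\<close> lets the same argument serve the squared modulus, the
  conjugate and the integrand of the integration by parts. The kernel may jump at the end points of
  the interval, which the integral does not see.\<close>

lemma has_integral_kernel_cong:
  assumes "j \<le> n" "((\<lambda>t. F t (rho_primitive k t - cst j)) has_integral I) {pt j..pt (Suc j)}"
  shows "((\<lambda>t. F t (ker t)) has_integral I) {pt j..pt (Suc j)}"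
proof -
  have "((\<lambda>t. F t (ker t)) has_integral I) (cbox (pt j) (pt (Suc j)))"
  proof (rule has_integral_spike_interior)
    show "((\<lambda>t. F t (rho_primitive k t - cst j)) has_integral I) (cbox (pt j) (pt (Suc j)))"
      using assms(2) by simp
    show "F t (ker t) = F t (rho_primitive k t - cst j)" if "t \<in> box (pt j) (pt (Suc j))" for t
      using that kernel_eq[OF assms(1), of t] by simp
  qed
  then show ?thesis by simp
qed

lemma has_integral_kernel_partition:
  fixes F :: "real \<Rightarrow> complex \<Rightarrow> 'b::banach"
  assumes "\<And>j. j \<le> n \<Longrightarrow> ((\<lambda>t. F t (rho_primitive k t - cst j)) has_integral I j) {pt j..pt (Suc j)}"
  shows "((\<lambda>t. F t (ker t)) has_integral (\<Sum>j\<le>n. I j)) {0..1}"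
proof -
  have "((\<lambda>t. F t (ker t)) has_integral (\<Sum>j<Suc n. I j)) {pt 0..pt (Suc n)}"
  proof (rule has_integral_partition)
    fix j assume "j < Suc n"
    then have j: "j \<le> n" by simp
    then show "pt j \<le> pt (Suc j)" by (intro partition_point_mono) auto
    show "((\<lambda>t. F t (ker t)) has_integral I j) {pt j..pt (Suc j)}"
      by (rule has_integral_kernel_cong[where F = F, OF j]) (rule assms[OF j])
  qed
  then show ?thesis by (simp add: partition_point_ends lessThan_Suc_atMost)
qed

lemma partition_point_less: "j \<in> {1..n-1} \<Longrightarrow> pt j < pt (Suc j)"
proof -
  assume j: "j \<in> {1..n-1}"
  then have "j \<le> n" by auto
  from partition_point_Suc_diff[OF this] admissible_nodes_gap(3)[OF adm n j]
  show ?thesis by linarith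
qed

lemma kernel_const_inner:
  "j \<in> {1..n-1} \<Longrightarrow> cst j = integral {pt j..pt (Suc j)} (rho_primitive k) / (pt (Suc j) - pt j)"
  using n by (auto simp: kernel_const_def partition_point_def)

lemma index_cases:
  assumes "j \<le> n"
  obtains "j = 0" | "j = n" "j \<noteq> 0" | "j \<in> {1..n-1}" "j \<noteq> 0" "j \<noteq> n"
  using assms n by (cases "j = 0"; cases "j = n") auto

text \<open>A boundary interval contributes twice its length and an inner one its length, each with
  a sine correction. As all gaps add up to 1, the lengths amount to the 1 and the two extra boundary
  gaps in \<open>radicand\<close>.\<close>

lemma has_integral_kernel_square:
  "((\<lambda>t. (cmod (ker t))\<^sup>2) has_integral radicand k n x / (4 * pi\<^sup>2 * k\<^sup>2)) {0..1}"
proof -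
  define E where "E j = (if j \<in> {0, n} then 2 * gap n x j - sin (2 * pi * k * gap n x j) / (pi * k)
    else gap n x j - (sin (pi * k * gap n x j))\<^sup>2 / (pi\<^sup>2 * k\<^sup>2 * gap n x j))" for j
  have "((\<lambda>t. (cmod (ker t))\<^sup>2) has_integral (\<Sum>j\<le>n. E j / (4 * pi\<^sup>2 * k\<^sup>2))) {0..1}"
  proof (rule has_integral_kernel_partition[where F = "\<lambda>_ z. (cmod z)\<^sup>2"])
    fix j assume j: "j \<le> n"
    have le: "pt j \<le> pt (Suc j)" using j by (intro partition_point_mono) auto
    note d = partition_point_Suc_diff[OF j]
    from j show "((\<lambda>t. (cmod (rho_primitive k t - cst j))\<^sup>2) has_integral E j / (4 * pi\<^sup>2 * k\<^sup>2)) {pt j..pt (Suc j)}"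
    proof (cases rule: index_cases)
      case 1
      with d partition_point_ends have "pt j = 0" "pt (Suc j) = gap n x j" by auto
      then show ?thesis
        using has_integral_square_end[OF k le, of 0] 1 by (simp add: E_def kernel_const_def)
    next
      case 2
      with d partition_point_ends have y: "pt (Suc j) = 1" "pt j = 1 - gap n x j" by auto
      then show ?thesis
        using has_integral_square_end[OF k le, of 1] 2 n unfolding y by (simp add: E_def kernel_const_def)
    next
      case 3
      then show ?thesis
        using has_integral_square_mean[OF k partition_point_less[OF 3(1)]]
        by (simp add: E_def kernel_const_inner d)
    qed
  qed
  moreover have "(\<Sum>j\<le>n. E j) = radicand k n x"
  proof -
    have "{..n} = insert 0 (insert n {1..n-1})" using n by auto
    then have "(\<Sum>j\<le>n. E j) = E 0 + E n + (\<Sum>j=1..n-1. E j)" using n by simp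
    also have "(\<Sum>j=1..n-1. E j) = (\<Sum>j=1..n-1. gap n x j - (sin (pi * k * gap n x j))\<^sup>2 / (pi\<^sup>2 * k\<^sup>2 * gap n x j))"
      using n by (intro sum.cong) (auto simp: E_def)
    also have "\<dots> = (\<Sum>j=1..n-1. gap n x j) - 1 / (pi\<^sup>2 * k\<^sup>2) * (\<Sum>j=1..n-1. (sin (pi * k * gap n x j))\<^sup>2 / gap n x j)"
      by (simp add: sum_subtractf sum_distrib_left)
    finally show ?thesis
      using admissible_nodes_gap(4)[OF adm n] by (simp add: E_def radicand_def)
  qed
  ultimately show ?thesis by (simp flip: sum_divide_distrib)
qed

lemma integrable_kernel_square: "integrable (lebesgue_on {0..1}) (\<lambda>t. (cmod (ker t))\<^sup>2)"
proof -
  obtain B where B: "B > 0" "\<And>t. cmod (ker t) \<le> B"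
    using kernel_bounded[of k n x] by (elim exE conjE) auto
  have "(\<lambda>t. (cmod (ker t))\<^sup>2) \<in> borel_measurable borel" by measurable
  then show "integrable (lebesgue_on {0..1}) (\<lambda>t. (cmod (ker t))\<^sup>2)"
    by (intro integrable_lebesgue_on_bounded[of _ _ _ "B\<^sup>2"] borel_measurable_lebesgue_onI)
       (auto intro: power_mono B)
qed

lemma integral_kernel_square:
  "integral\<^sup>L (lebesgue_on {0..1}) (\<lambda>t. (cmod (ker t))\<^sup>2) = radicand k n x / (4 * pi\<^sup>2 * k\<^sup>2)"
  using lebesgue_integral_eq_integral[OF integrable_kernel_square] has_integral_kernel_square
  by (simp add: integral_unique)

lemma radicand_nonneg: "radicand k n x / (4 * pi\<^sup>2 * k\<^sup>2) \<ge> 0"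
  unfolding integral_kernel_square[symmetric] by (intro Bochner_Integration.integral_nonneg) auto

text \<open>Integration by parts on each interval: f (P - c) is absolutely continuous with
  derivative f' (P - c) + f \<rho> almost everywhere. Its boundary values vanish, at the nodes
  because of f and at 0 and 1 because of P - c.\<close>

lemma weighted_integral_eq_kernel:
  assumes f: "f \<in> H1" and zero: "\<And>j. j \<in> {1..n} \<Longrightarrow> f (x j) = 0"
  shows "integrable (lebesgue_on {0..1}) (\<lambda>t. deriv01 f t * ker t)"
    and "weighted_integral (rho k) f = - integral\<^sup>L (lebesgue_on {0..1}) (\<lambda>t. deriv01 f t * ker t)"
proof -
  have ac: "absolutely_continuous_on_interval 0 1 f" using f by (simp add: H1_def)
  obtain B where B: "B > 0" "\<And>t. cmod (ker t) \<le> B"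
    using kernel_bounded[of k n x] by (elim exE conjE) auto
  show int1: "integrable (lebesgue_on {0..1}) (\<lambda>t. deriv01 f t * ker t)"
  proof (rule Bochner_Integration.integrable_bound)
    show "integrable (lebesgue_on {0..1}) (\<lambda>t. B *\<^sub>R deriv01 f t)"
      by (intro integrable_scaleR_right integrable_deriv01 f)
    show "(\<lambda>t. deriv01 f t * ker t) \<in> borel_measurable (lebesgue_on {0..1})"
      using f by (intro borel_measurable_times[OF _ borel_measurable_lebesgue_onI[OF borel_measurable_kernel]])
        (simp add: H1_def)
    show "AE t in lebesgue_on {0..1}. norm (deriv01 f t * ker t) \<le> norm (B *\<^sub>R deriv01 f t)"
      using B by (intro AE_I2) (simp add: norm_mult mult.commute[of "cmod (deriv01 f _)"] mult_right_mono)
  qed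
  have int2: "integrable (lebesgue_on {0..1}) (\<lambda>t. f t * rho k t)"
    using absolutely_continuous_on_interval_imp_continuous_on[OF ac]
    by (intro continuous_imp_integrable_real continuous_on_mult continuous_on_rho)
  have AE: "AE t in lebesgue_on {0..1}. f differentiable (at t within {0..1})"
    using f by (simp add: H1_def)
  obtain N where N: "negligible N" "\<And>t. t \<in> {0..1} - N \<Longrightarrow> f differentiable (at t within {0..1})"
    by (rule AE_lebesgue_on_negligible[OF _ AE]) (simp, rule that)
  have zero_int: "((\<lambda>t. deriv01 f t * ker t + f t * rho k t) has_integral (\<Sum>j\<le>n. 0)) {0..1}"
  proof (rule has_integral_kernel_partition[where F = "\<lambda>t z. deriv01 f t * z + f t * rho k t"])
    fix j assume j: "j \<le> n"
    let ?h = "\<lambda>t. f t * (rho_primitive k t - cst j)"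
    note b = partition_point_bounds[of j] partition_point_bounds[of "Suc j"]
    have "((\<lambda>t. deriv01 f t * (rho_primitive k t - cst j) + f t * rho k t) has_integral
        ?h (pt (Suc j)) - ?h (pt j)) {pt j..pt (Suc j)}"
    proof (rule fundamental_theorem_of_calculus_absolutely_continuous[OF _ _ N(1)])
      show "pt j \<le> pt (Suc j)" using j by (intro partition_point_mono) auto
      have "absolutely_continuous_on_interval (pt j) (pt (Suc j)) f"
        using j b by (intro absolutely_continuous_on_interval_subset[OF ac]) auto
      moreover have "absolutely_continuous_on_interval (pt j) (pt (Suc j)) (\<lambda>t. rho_primitive k t - cst j)"
        using lipschitz_rho_primitive[OF k]
        by (intro lipschitz_on_imp_absolutely_continuous_on_interval[of _ _ _ 1]) auto
      ultimately show "absolutely_continuous_on_interval (pt j) (pt (Suc j)) ?h"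
        by (rule absolutely_continuous_on_interval_mult)
      fix t assume t: "t \<in> {pt j..pt (Suc j)} - N"
      then have "t \<in> {0..1} - N" using j b by auto
      then have "(f has_vector_derivative deriv01 f t) (at t within {0..1})"
        unfolding deriv01_def by (intro vector_derivative_works[THEN iffD1] N(2))
      then have "(f has_vector_derivative deriv01 f t) (at t within {pt j..pt (Suc j)})"
        by (rule has_vector_derivative_within_subset) (use j b in auto)
      moreover have "((\<lambda>t. rho_primitive k t - cst j) has_vector_derivative rho k t - 0) (at t within {pt j..pt (Suc j)})"
        by (intro has_vector_derivative_diff has_vector_derivative_rho_primitive k has_vector_derivative_const)
      ultimately have "(?h has_vector_derivative f t * (rho k t - 0) + deriv01 f t * (rho_primitive k t - cst j))
          (at t within {pt j..pt (Suc j)})"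
        by (rule has_vector_derivative_mult)
      then show "(?h has_vector_derivative deriv01 f t * (rho_primitive k t - cst j) + f t * rho k t)
          (at t within {pt j..pt (Suc j)})"
        by (simp add: add.commute)
    qed
    \<comment> \<open>For \<open>j = n\<close> the right end is 1, where the factor P - P 1
      vanishes; otherwise it is the node with index \<open>Suc j\<close>. The left end is treated
      likewise, with \<open>j = 0\<close> as the exception.\<close>
    moreover have "?h (pt (Suc j)) = 0"
      using j n zero[of "Suc j"] by (cases "j = n") (auto simp: partition_point_def kernel_const_def)
    moreover have "?h (pt j) = 0"
      using j n zero[of j] by (cases "j = 0") (auto simp: partition_point_def kernel_const_def)
    ultimately show "((\<lambda>t. deriv01 f t * (rho_primitive k t - cst j) + f t * rho k t) has_integral 0)
        {pt j..pt (Suc j)}" by simp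
  qed
  have "((\<lambda>t. deriv01 f t * ker t + f t * rho k t) has_integral
      integral\<^sup>L (lebesgue_on {0..1}) (\<lambda>t. deriv01 f t * ker t + f t * rho k t)) {0..1}"
    by (intro has_integral_integral_lebesgue_on Bochner_Integration.integrable_add int1 int2) simp
  from has_integral_unique[OF this zero_int]
  have "integral\<^sup>L (lebesgue_on {0..1}) (\<lambda>t. deriv01 f t * ker t + f t * rho k t) = 0"
    by simp
  then show "weighted_integral (rho k) f = - integral\<^sup>L (lebesgue_on {0..1}) (\<lambda>t. deriv01 f t * ker t)"
    unfolding weighted_integral_def Bochner_Integration.integral_add[OF int1 int2]
    by (simp only: eq_neg_iff_add_eq_0 add.commute)
qed

text \<open>The Cauchy-Schwarz inequality is obtained from p q \<le> s p^2 / 2 + q^2 / (2 s) with a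
  free parameter s > 0. The choice \<open>s = sqrt V\<close> is optimal if V is positive; for V = 0
  the parameter is made arbitrarily small.\<close>

lemma cmod_weighted_integral_le:
  assumes f: "f \<in> H1" "H1_seminorm f \<le> 1" and zero: "\<And>j. j \<in> {1..n} \<Longrightarrow> f (x j) = 0"
  shows "cmod (weighted_integral (rho k) f) \<le> sqrt (radicand k n x / (4 * pi\<^sup>2 * k\<^sup>2))"
proof -
  define V where "V = radicand k n x / (4 * pi\<^sup>2 * k\<^sup>2)"
  define A where "A = integral\<^sup>L (lebesgue_on {0..1}) (\<lambda>t. (cmod (deriv01 f t))\<^sup>2)"
  note int = weighted_integral_eq_kernel[OF f(1) zero]
  have V: "V \<ge> 0" using radicand_nonneg by (simp add: V_def)
  have A1: "A \<le> 1" using f(2) by (simp add: H1_seminorm_def A_def)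
  have int_deriv: "integrable (lebesgue_on {0..1}) (\<lambda>t. (cmod (deriv01 f t))\<^sup>2)"
    using f(1) by (simp add: H1_def)
  have le: "cmod (weighted_integral (rho k) f) \<le> (s + V / s) / 2" if s: "s > 0" for s
  proof -
    have int1: "integrable (lebesgue_on {0..1}) (\<lambda>t. (s / 2) * (cmod (deriv01 f t))\<^sup>2)"
      by (rule integrable_mult_right[OF int_deriv])
    have int2: "integrable (lebesgue_on {0..1}) (\<lambda>t. (1 / (2 * s)) * (cmod (ker t))\<^sup>2)"
      by (rule integrable_mult_right[OF integrable_kernel_square])
    have "cmod (weighted_integral (rho k) f) = cmod (integral\<^sup>L (lebesgue_on {0..1}) (\<lambda>t. deriv01 f t * ker t))"
      using int(2) by simp
    also have "\<dots> \<le> integral\<^sup>L (lebesgue_on {0..1}) (\<lambda>t. cmod (deriv01 f t * ker t))"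
      by (rule integral_norm_bound)
    also have "\<dots> \<le> integral\<^sup>L (lebesgue_on {0..1}) (\<lambda>t. (s / 2) * (cmod (deriv01 f t))\<^sup>2 + (1 / (2 * s)) * (cmod (ker t))\<^sup>2)"
    proof (rule integral_mono)
      show "integrable (lebesgue_on {0..1}) (\<lambda>t. cmod (deriv01 f t * ker t))"
        by (intro integrable_norm int(1))
      show "integrable (lebesgue_on {0..1}) (\<lambda>t. (s / 2) * (cmod (deriv01 f t))\<^sup>2 + (1 / (2 * s)) * (cmod (ker t))\<^sup>2)"
        by (rule Bochner_Integration.integrable_add[OF int1 int2])
      have "p * q \<le> (s / 2) * p\<^sup>2 + (1 / (2 * s)) * q\<^sup>2" for p q :: real
      proof -
        have "0 \<le> (s * p - q)\<^sup>2 / (2 * s)" using s by simp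
        also have "\<dots> = (s / 2) * p\<^sup>2 + (1 / (2 * s)) * q\<^sup>2 - p * q"
          using s by (simp add: power2_eq_square field_simps)
        finally show ?thesis by simp
      qed
      then show "cmod (deriv01 f t * ker t) \<le> (s / 2) * (cmod (deriv01 f t))\<^sup>2 + (1 / (2 * s)) * (cmod (ker t))\<^sup>2" for t
        by (simp only: norm_mult)
    qed
    also have "\<dots> = (s / 2) * A + (1 / (2 * s)) * V"
      unfolding Bochner_Integration.integral_add[OF int1 int2] A_def V_def integral_kernel_square[symmetric]
      by (simp only: integral_mult_right_zero)
    also have "\<dots> \<le> (s / 2) * 1 + (1 / (2 * s)) * V"
      using A1 s by (intro add_right_mono mult_left_mono) auto
    finally show ?thesis by (simp add: add_divide_distrib)
  qed
  have "cmod (weighted_integral (rho k) f) \<le> sqrt V"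
  proof (cases "V = 0")
    case True
    have "cmod (weighted_integral (rho k) f) \<le> 0 + e" if "e > 0" for e
      using le[of "2 * e"] True that by simp
    then show ?thesis using True field_le_epsilon[of "cmod (weighted_integral (rho k) f)" 0] by simp
  next
    case False
    then have "sqrt V > 0" "V / sqrt V = sqrt V" using V by (auto simp: real_div_sqrt)
    then show ?thesis using le[of "sqrt V"] by simp
  qed
  then show ?thesis by (simp add: V_def)
qed

section \<open>An extremal function and the value of the radius\<close>

lemma borel_measurable_cnj_kernel: "(\<lambda>t. cnj (ker t)) \<in> borel_measurable borel"
proof -
  have "cnj \<in> borel_measurable borel" by (intro borel_measurable_continuous_onI continuous_intros)
  from measurable_compose[OF borel_measurable_kernel this] show ?thesis .
qed

text \<open>Subtracting the mean makes the integral zero, so a primitive of the conjugate kernel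
  takes equal values at neighbouring nodes.\<close>

lemma has_integral_cnj_kernel_inner:
  assumes j: "j \<in> {1..n-1}"
  shows "((\<lambda>t. cnj (ker t)) has_integral 0) {pt j..pt (Suc j)}"
proof -
  have jn: "j \<le> n" using j by auto
  let ?c = "kernel_const k n x j"
  note less = partition_point_less[OF j]
  have "(rho_primitive k has_integral integral {pt j..pt (Suc j)} (rho_primitive k)) {pt j..pt (Suc j)}"
    by (intro integrable_integral integrable_continuous_real continuous_on_rho_primitive)
  moreover have "((\<lambda>t. ?c) has_integral (pt (Suc j) - pt j) *\<^sub>R ?c) {pt j..pt (Suc j)}"
    using has_integral_const_real[of ?c "pt j" "pt (Suc j)"] less by simp
  ultimately have "((\<lambda>t. rho_primitive k t - ?c) has_integral
      integral {pt j..pt (Suc j)} (rho_primitive k) - (pt (Suc j) - pt j) *\<^sub>R ?c) {pt j..pt (Suc j)}"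
    by (rule has_integral_diff)
  moreover have "integral {pt j..pt (Suc j)} (rho_primitive k) - (pt (Suc j) - pt j) *\<^sub>R ?c = 0"
  proof -
    have "of_real (pt (Suc j)) - of_real (pt j) \<noteq> (0 :: complex)" using less by (simp flip: of_real_diff)
    then show ?thesis by (simp add: kernel_const_inner[OF j] scaleR_conv_of_real)
  qed
  ultimately have "((\<lambda>t. rho_primitive k t - ?c) has_integral 0) {pt j..pt (Suc j)}" by simp
  from has_integral_linear[OF this bounded_linear_cnj]
  have "((\<lambda>t. cnj (rho_primitive k t - ?c)) has_integral 0) {pt j..pt (Suc j)}"
    by (simp add: o_def)
  then show ?thesis
    by (rule has_integral_kernel_cong[OF jn, where F = "\<lambda>_ z. cnj z"])
qed

lemma partition_point_interval:
  assumes "t \<in> {0..1} - pt ` {..Suc n}"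
  obtains j where "j \<le> n" "t \<in> {pt j<..<pt (Suc j)}"
proof -
  \<comment> \<open>Partition points may coincide when 0 or 1 is a node. The least index whose point
    exceeds \<open>t\<close> has a predecessor whose point does not, which yields an interval of
    positive length.\<close>
  define i where "i = (LEAST i. t < pt i)"
  have "t \<noteq> pt (Suc n)" using assms by blast
  moreover have "t \<le> pt (Suc n)" using assms by (simp add: partition_point_ends)
  ultimately have t1: "t < pt (Suc n)" by linarith
  have i: "t < pt i" unfolding i_def by (rule LeastI[of "\<lambda>i. t < pt i", OF t1])
  have "i \<le> Suc n" unfolding i_def by (rule Least_le[of "\<lambda>i. t < pt i", OF t1])
  have "i \<noteq> 0" using i assms partition_point_ends(1) by (intro notI) simp
  then obtain j where j: "i = Suc j" by (cases i) auto
  have "\<not> t < pt j" using not_less_Least[of j "\<lambda>i. t < pt i"] j by (simp add: i_def)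
  moreover have "t \<noteq> pt j" using assms j \<open>i \<le> Suc n\<close> by auto
  ultimately show thesis using that[of j] i j \<open>i \<le> Suc n\<close> by auto
qed

text \<open>Equality in Cauchy-Schwarz requires f' to be a multiple of the conjugate kernel. The
  primitive is normalised to vanish at the first node and then vanishes at all others, the kernel
  having mean zero between neighbouring nodes.\<close>

lemma exists_extremal_function:
  obtains f where "f \<in> H1" "H1_seminorm f \<le> 1" "\<And>j. j \<in> {1..n} \<Longrightarrow> f (x j) = 0"
    "cmod (weighted_integral (rho k) f) = sqrt (radicand k n x / (4 * pi\<^sup>2 * k\<^sup>2))"
proof -
  define V where "V = radicand k n x / (4 * pi\<^sup>2 * k\<^sup>2)"
  define s where "s = sqrt V"
  define g where "g t = cnj (ker t)" for t
  define G where "G t = integral {0..t} g" for t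
  \<comment> \<open>If \<open>s = 0\<close>, division by zero makes \<open>f\<close> the zero
    function, which is extremal in that case. The later steps are phrased to cover it.\<close>
  define f where "f t = (1 / complex_of_real s) * (G t - G (x 1))" for t
  define Y where "Y = pt ` {..Suc n}"
  let ?M = "lebesgue_on {0..1::real}"
  have V: "V \<ge> 0" unfolding V_def by (rule radicand_nonneg)
  then have s: "s \<ge> 0" "s\<^sup>2 = V" by (auto simp: s_def)
  obtain B where B: "B > 0" "\<And>t. cmod (ker t) \<le> B"
    using kernel_bounded[of k n x] by (elim exE conjE) auto
  have g_meas: "g \<in> borel_measurable ?M"
    unfolding g_def[abs_def] by (intro borel_measurable_lebesgue_onI borel_measurable_cnj_kernel)
  have "integrable ?M g"
    by (rule integrable_lebesgue_on_bounded[OF g_meas, of B]) (simp add: g_def B)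
  then have g_int: "g integrable_on {0..1}" by (rule integrable_on_lebesgue_on) simp
  have G_diff: "G b - G a = integral {a..b} g \<and> g integrable_on {a..b}" if "0 \<le> a" "a \<le> b" "b \<le> 1" for a b
  proof -
    have gb: "g integrable_on {0..b}" by (rule integrable_on_subinterval[OF g_int]) (use that in auto)
    have "g integrable_on {a..b}" by (rule integrable_on_subinterval[OF g_int]) (use that in auto)
    then show ?thesis
      using Henstock_Kurzweil_Integration.integral_combine[OF that(1,2) gb] by (simp add: G_def algebra_simps)
  qed
  have G_lip: "cmod (G b - G a) \<le> B * (b - a)" if "0 \<le> a" "a \<le> b" "b \<le> 1" for a b
  proof -
    from G_diff[OF that] have "(g has_integral G b - G a) {a..b}"
      using integrable_integral[of g "{a..b}"] by simp
    from has_integral_bound_real[OF _ finite.emptyI this, of B] B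
    have "cmod (G b - G a) \<le> B * measure lborel {a..b}" by (simp add: g_def)
    then show ?thesis using that by simp
  qed
  have ac: "absolutely_continuous_on_interval 0 1 f"
  proof (rule lipschitz_on_imp_absolutely_continuous_on_interval)
    fix a b :: real assume "0 \<le> a" "a \<le> b" "b \<le> 1"
    from G_lip[OF this] have "cmod (G b - G a) / s \<le> B * (b - a) / s"
      using s(1) by (rule divide_right_mono)
    moreover have "f b - f a = (G b - G a) / complex_of_real s"
      by (simp add: f_def diff_divide_distrib)
    ultimately show "cmod (f b - f a) \<le> (B / s) * (b - a)"
      using s(1) by (simp add: norm_divide)
  qed
  have Y: "finite Y" "Y \<subseteq> {0..1}"
    using partition_point_bounds by (auto simp: Y_def)
  have der: "(f has_vector_derivative g t / s) (at t within {0..1})" if t: "t \<in> {0..1} - Y" for t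
  proof -
    obtain j where j: "j \<le> n" "t \<in> {pt j<..<pt (Suc j)}"
      using partition_point_interval t unfolding Y_def by blast
    have "continuous_on {pt j<..<pt (Suc j)} (\<lambda>t. cnj (rho_primitive k t - kernel_const k n x j))"
      by (intro continuous_on_cnj continuous_on_diff continuous_on_rho_primitive continuous_on_const)
    moreover have "cnj (rho_primitive k t - kernel_const k n x j) = g t" if "t \<in> {pt j<..<pt (Suc j)}" for t
      using kernel_eq[OF j(1) that] by (simp add: g_def)
    ultimately have "continuous_on {pt j<..<pt (Suc j)} g"
      by (rule continuous_on_eq)
    then have "continuous (at t) g"
      using j(2) continuous_on_eq_continuous_at[OF open_greaterThanLessThan] by blast
    then have "continuous (at t within ({0..1} - {})) g"
      by (rule continuous_at_imp_continuous_at_within)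
    from integral_has_vector_derivative_continuous_at[OF g_int _ finite.emptyI this] t
    have "(G has_vector_derivative g t) (at t within {0..1})"
      by (simp add: G_def[abs_def])
    from has_vector_derivative_mult_right[OF has_vector_derivative_diff[OF this has_vector_derivative_const], of "1 / complex_of_real s" "G (x 1)"]
    show ?thesis by (simp add: f_def[abs_def])
  qed
  have deriv: "deriv01 f t = g t / s" if "t \<in> {0..1} - Y" for t
    unfolding deriv01_def
    by (rule vector_derivative_within_closed_interval[OF _ _ der[OF that]]) (use that in auto)
  have AE_Y: "AE t in ?M. t \<in> {0..1} - Y"
  proof -
    have "Y \<in> null_sets lebesgue" using negligible_finite[OF Y(1)] by (simp add: negligible_iff_null_sets)
    then have "Y \<in> null_sets ?M" using Y(2) by (simp add: null_sets_restrict_space)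
    from AE_not_in[OF this] AE_space[of ?M] show ?thesis
      by eventually_elim simp
  qed
  have gs_meas: "(\<lambda>t. g t / complex_of_real s) \<in> borel_measurable ?M"
    by (intro borel_measurable_divide g_meas borel_measurable_const)
  have deriv_meas: "deriv01 f \<in> borel_measurable ?M"
  \<comment> \<open>At break points \<open>deriv01 f\<close> may be an unspecified value; there are
    only finitely many of them, so measurability carries over from \<open>g\<close> divided by
    \<open>s\<close>.\<close>
  proof (rule measurable_discrete_difference[OF gs_meas])
    show "countable Y" using Y(1) by (rule countable_finite)
    show "{t} \<in> sets ?M" if "t \<in> Y" for t
      using that Y(2) by (subst sets_restrict_space_iff) auto
    show "g t / complex_of_real s = deriv01 f t" if "t \<in> space ?M" "t \<notin> Y" for t
      using that by (intro deriv[symmetric]) simp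
  qed simp
  have sq: "AE t in ?M. (cmod (deriv01 f t))\<^sup>2 = (1 / V) * (cmod (ker t))\<^sup>2"
    using AE_Y
  proof eventually_elim
    case (elim t)
    then show ?case using s by (simp add: deriv norm_divide power_divide g_def)
  qed
  have K2_int: "integrable ?M (\<lambda>t. (cmod (ker t))\<^sup>2)" by (rule integrable_kernel_square)
  have K2: "integral\<^sup>L ?M (\<lambda>t. (cmod (ker t))\<^sup>2) = V"
    unfolding V_def by (rule integral_kernel_square)
  have sq_meas: "(\<lambda>t. (cmod (deriv01 f t))\<^sup>2) \<in> borel_measurable ?M"
    using deriv_meas by measurable
  have KV_meas: "(\<lambda>t. (1 / V) * (cmod (ker t))\<^sup>2) \<in> borel_measurable ?M"
    by (intro borel_measurable_integrable integrable_mult_right K2_int)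
  have sq_int: "integrable ?M (\<lambda>t. (cmod (deriv01 f t))\<^sup>2)"
    using integrable_mult_right[OF K2_int, of "1 / V"] integrable_cong_AE[OF sq_meas KV_meas sq] by simp
  \<comment> \<open>The product is left as it is because it equals 1 for \<open>V > 0\<close> but 0
    for \<open>V = 0\<close>; it is at most 1 in both cases.\<close>
  have sq_val: "integral\<^sup>L ?M (\<lambda>t. (cmod (deriv01 f t))\<^sup>2) = (1 / V) * V"
    unfolding integral_cong_AE[OF sq_meas KV_meas sq] by (simp add: K2)
  have f_H1: "f \<in> H1"
    unfolding H1_def
  proof (intro CollectI conjI ac deriv_meas sq_int)
    show "AE t in ?M. f differentiable (at t within {0..1})"
      using AE_Y by eventually_elim (use der differentiableI_vector in blast)
  qed
  have zero: "f (x j) = 0" if "j \<in> {1..n}" for j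
  proof -
    have "1 \<le> j" "j \<le> n" using that by auto
    then have "G (pt j) = G (pt 1)"
    proof (induction rule: dec_induct)
      case (step m)
      then have m: "m \<in> {1..n-1}" by auto
      have "G (pt (Suc m)) - G (pt m) = integral {pt m..pt (Suc m)} g"
        using G_diff[of "pt m" "pt (Suc m)"] partition_point_bounds[of m]
          partition_point_bounds[of "Suc m"] partition_point_less[OF m] step by auto
      also have "\<dots> = 0"
        using has_integral_cnj_kernel_inner[OF m] unfolding g_def[abs_def] by (rule integral_unique)
      finally show ?case using step by simp
    qed simp
    then show ?thesis using that n by (simp add: f_def partition_point_def)
  qed
  have "weighted_integral (rho k) f = - integral\<^sup>L ?M (\<lambda>t. deriv01 f t * ker t)"
    by (rule weighted_integral_eq_kernel(2)[OF f_H1 zero])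
  also have "integral\<^sup>L ?M (\<lambda>t. deriv01 f t * ker t) = integral\<^sup>L ?M (\<lambda>t. complex_of_real ((1 / s) * (cmod (ker t))\<^sup>2))"
  proof (rule integral_cong_AE)
    show "(\<lambda>t. deriv01 f t * ker t) \<in> borel_measurable ?M"
      by (intro borel_measurable_integrable weighted_integral_eq_kernel(1)[OF f_H1 zero])
    show "(\<lambda>t. complex_of_real ((1 / s) * (cmod (ker t))\<^sup>2)) \<in> borel_measurable ?M"
      by (intro borel_measurable_integrable integrable_of_real integrable_mult_right K2_int)
    show "AE t in ?M. deriv01 f t * ker t = complex_of_real ((1 / s) * (cmod (ker t))\<^sup>2)"
      using AE_Y
    proof eventually_elim
      case (elim t)
      have "complex_of_real ((cmod (ker t))\<^sup>2) = ker t * cnj (ker t)" by (rule complex_norm_square)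
      then show ?case using elim by (simp add: deriv g_def mult.commute)
    qed
  qed
  also have "\<dots> = complex_of_real ((1 / s) * V)"
    by (simp only: integral_complex_of_real integral_mult_right_zero K2)
  finally have "weighted_integral (rho k) f = - complex_of_real ((1 / s) * V)" .
  then have "cmod (weighted_integral (rho k) f) = \<bar>(1 / s) * V\<bar>"
    by (simp only: norm_minus_cancel norm_of_real)
  \<comment> \<open>Since V is the square of \<open>s\<close>, the quotient is \<open>s\<close>; for
    \<open>s = 0\<close> both sides are 0.\<close>
  also have "\<dots> = s"
    using s by (cases "s = 0") (auto simp: power2_eq_square)
  finally have val: "cmod (weighted_integral (rho k) f) = sqrt V" by (simp add: s_def)
  have "(1 / V) * V \<le> 1" by (cases "V = 0") auto
  then have "H1_seminorm f \<le> 1"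
    unfolding H1_seminorm_def sq_val by simp
  from that[OF f_H1 this zero] val show thesis by (simp add: V_def)
qed

lemma radius_eq: "radius k n x = ereal (1 / (2 * pi * \<bar>k\<bar>) * sqrt (radicand k n x))"
proof -
  have eq: "sqrt (radicand k n x / (4 * pi\<^sup>2 * k\<^sup>2)) = 1 / (2 * pi * \<bar>k\<bar>) * sqrt (radicand k n x)"
    by (simp add: real_sqrt_divide real_sqrt_mult)
  show ?thesis
    unfolding radius_def eq[symmetric]
  proof (rule antisym)
    show "(SUP f\<in>{f \<in> H1. H1_seminorm f \<le> 1 \<and> information n x f = replicate n 0}.
        ereal (cmod (weighted_integral (rho k) f))) \<le> ereal (sqrt (radicand k n x / (4 * pi\<^sup>2 * k\<^sup>2)))"
    proof (rule SUP_least)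
      fix f assume "f \<in> {f \<in> H1. H1_seminorm f \<le> 1 \<and> information n x f = replicate n 0}"
      then have f: "f \<in> H1" "H1_seminorm f \<le> 1" "\<And>j. j \<in> {1..n} \<Longrightarrow> f (x j) = 0"
        by (auto simp: information_eq_replicate_0_iff)
      show "ereal (cmod (weighted_integral (rho k) f)) \<le> ereal (sqrt (radicand k n x / (4 * pi\<^sup>2 * k\<^sup>2)))"
        using cmod_weighted_integral_le[OF f] by simp
    qed
    obtain f where f: "f \<in> H1" "H1_seminorm f \<le> 1" "\<forall>j\<in>{1..n}. f (x j) = 0"
      "cmod (weighted_integral (rho k) f) = sqrt (radicand k n x / (4 * pi\<^sup>2 * k\<^sup>2))"
      by (rule exists_extremal_function) auto
    then have "f \<in> {f \<in> H1. H1_seminorm f \<le> 1 \<and> information n x f = replicate n 0}"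
      by (simp add: information_eq_replicate_0_iff)
    then show "ereal (sqrt (radicand k n x / (4 * pi\<^sup>2 * k\<^sup>2))) \<le>
      (SUP f\<in>{f \<in> H1. H1_seminorm f \<le> 1 \<and> information n x f = replicate n 0}.
        ereal (cmod (weighted_integral (rho k) f)))"
      by (rule SUP_upper2) (simp add: f(4))
  qed
qed

end

section \<open>Optimal nodes for either sign of k\<close>

lemma radius_le:
  assumes "k \<noteq> 0" "n \<ge> 1" "admissible_nodes n x" "admissible_nodes n y"
    and "radicand \<bar>k\<bar> n x \<le> radicand \<bar>k\<bar> n y"
  shows "radius k n x \<le> radius k n y"
  using assms unfolding radius_eq[OF assms(1,2,3)] radius_eq[OF assms(1,2,4)] radicand_abs
  by (simp add: divide_right_mono)

lemma optimal_nodes_equidistant: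
  assumes k: "k \<noteq> 0" and n: "real n - 1 \<ge> 2.7 * \<bar>k\<bar>"
    and t: "t \<in> {0<..<min (1/2) (1 / (6 * \<bar>k\<bar>))}" "stationary_point (S_fun k n) t"
    and x: "x 1 = t" "1 - x n = t"
      "\<And>j. j \<in> {2..n-1} \<Longrightarrow> x j = (real j - 1) / (real n - 1) * (x n - x 1) + x 1"
  shows "optimal_nodes k n x"
proof -
  have k': "\<bar>k\<bar> > 0" using k by simp
  have n1: "real n > 1" by (rule n_gt_1[OF k' n])
  then have n2: "n \<ge> 2" by simp
  have d: "1 - 2 * t > 0" using t by simp
  have xn: "x n = 1 - t" using x by simp
  \<comment> \<open>The equidistant formula is assumed for indices strictly between 1 and
    \<open>n\<close>. It extends to both ends, which makes all inner gaps equal.\<close>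
  have xj: "x j = (real j - 1) * ((1 - 2 * t) / (real n - 1)) + t" if "j \<in> {1..n}" for j
  proof -
    have "j = 1 \<or> j = n \<or> j \<in> {2..n-1}" using that unfolding atLeastAtMost_iff by arith
    then consider "j = 1" | "j = n" | "j \<in> {2..n-1}" by blast
    then show ?thesis
    proof cases
      case 2
      have "(real n - 1) * ((1 - 2 * t) / (real n - 1)) = 1 - 2 * t" using n1 by simp
      then show ?thesis using 2 xn by simp
    next
      case 3
      have "1 - t - t = 1 - 2 * t" by simp
      with x(3)[OF 3] show ?thesis unfolding x(1) xn by simp
    qed (use x in simp)
  qed
  have "strict_mono_on {1..n} x"
  proof (rule strict_mono_onI)
    fix i j assume ij: "i \<in> {1..n}" "j \<in> {1..n}" "i < j"
    then show "x i < x j"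
      unfolding xj[OF ij(1)] xj[OF ij(2)] using d n1
      by (intro add_strict_right_mono mult_strict_right_mono divide_pos_pos) auto
  qed
  then have adm: "admissible_nodes n x"
    using t x xn by (simp add: admissible_nodes_def)
  have gaps: "gap n x 0 = t" "gap n x n = t" using x n2 by (auto simp: gap_def)
  have gap_j: "gap n x j = (1 - 2 * t) / (real n - 1)" if "j \<in> {1..n-1}" for j
  proof -
    have "gap n x j = x (j + 1) - x j" using that by (auto simp: gap_def)
    also have "\<dots> = (1 - 2 * t) / (real n - 1)"
    proof -
      define w where "w = (1 - 2 * t) / (real n - 1)"
      have "j \<in> {1..n}" "j + 1 \<in> {1..n}" using that by auto
      from this[THEN xj] show ?thesis unfolding w_def[symmetric] by (simp add: algebra_simps)
    qed
    finally show ?thesis .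
  qed
  \<comment> \<open>The minimisation was carried out for positive parameters, hence the passage to
    the absolute value of \<open>k\<close>.\<close>
  have S: "stationary_point (S_fun \<bar>k\<bar> n) t"
    using t(2) by (simp add: S_fun_abs[abs_def] S_fun_abs stationary_point_def)
  show ?thesis
    unfolding optimal_nodes_def
  proof (intro conjI adm allI impI)
    fix y assume y: "admissible_nodes n y"
    show "radius k n x \<le> radius k n y"
      using n2 by (intro radius_le k adm y radicand_le[OF k' n t(1) S gaps gap_j y]) auto
  qed
qed

theorem theorem13:
  fixes k :: real and n :: nat
  assumes "k \<noteq> 0" and "n \<ge> 1"
  shows "(\<forall>x. admissible_nodes n x \<longrightarrow>
            radius k n x = ereal (1 / (2 * pi * \<bar>k\<bar>) *
              sqrt (gap n x 0 - sin (2 * pi * k * gap n x 0) / (pi * k)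
                  + gap n x n - sin (2 * pi * k * gap n x n) / (pi * k)
                  + 1 - 1 / (pi\<^sup>2 * k\<^sup>2)
                        * (\<Sum>j=1..n-1. (sin (pi * k * gap n x j))\<^sup>2 / gap n x j))))
       \<and> (real n - 1 \<ge> 2.7 * \<bar>k\<bar> \<longrightarrow>
            (\<exists>!t. t \<in> {0<..<min (1/2) (1 / (6 * \<bar>k\<bar>))} \<and> stationary_point (S_fun k n) t) \<and>
            (\<forall>t x. t \<in> {0<..<min (1/2) (1 / (6 * \<bar>k\<bar>))} \<and> stationary_point (S_fun k n) t \<and>
                   x 1 = t \<and> 1 - x n = t \<and>
                   (\<forall>j\<in>{2..n-1}. x j = (real j - 1) / (real n - 1) * (x n - x 1) + x 1)
                   \<longrightarrow> optimal_nodes k n x))"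
proof (intro conjI allI impI)
  fix x assume "admissible_nodes n x"
  from radius_eq[OF assms this]
  show "radius k n x = ereal (1 / (2 * pi * \<bar>k\<bar>) *
              sqrt (gap n x 0 - sin (2 * pi * k * gap n x 0) / (pi * k)
                  + gap n x n - sin (2 * pi * k * gap n x n) / (pi * k)
                  + 1 - 1 / (pi\<^sup>2 * k\<^sup>2)
                        * (\<Sum>j=1..n-1. (sin (pi * k * gap n x j))\<^sup>2 / gap n x j)))"
    unfolding radicand_def .
next
  assume n: "real n - 1 \<ge> 2.7 * \<bar>k\<bar>"
  have "S_fun \<bar>k\<bar> n = S_fun k n" by (rule ext) (rule S_fun_abs)
  then show "\<exists>!t. t \<in> {0<..<min (1/2) (1 / (6 * \<bar>k\<bar>))} \<and> stationary_point (S_fun k n) t"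
    using ex1_stationary_point_S_fun[of "\<bar>k\<bar>" n] assms(1) n by simp
next
  fix t x
  assume "real n - 1 \<ge> 2.7 * \<bar>k\<bar>"
    and "t \<in> {0<..<min (1/2) (1 / (6 * \<bar>k\<bar>))} \<and> stationary_point (S_fun k n) t \<and>
         x 1 = t \<and> 1 - x n = t \<and>
         (\<forall>j\<in>{2..n-1}. x j = (real j - 1) / (real n - 1) * (x n - x 1) + x 1)"
  then show "optimal_nodes k n x"
    using assms(1) by (intro optimal_nodes_equidistant) auto
qed

end
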